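(* Let $U_h^0\in\mathcal K_h$ be the initial solution at time $t=0$ satisfying $\|U_h^0-u_0\|_0\le Ch$. Then, at every time step $t^{n+1}$, $0\le n\le N-1$, the solution $U_h^{n+1}$ of the fully discrete scheme $$U_h^{n+1}\in\mathcal K_h:\quad m_h(\partial U_h^n,v_h-U_h^{n+1})+a_h(U_h^{n+1},v_h-U_h^{n+1})\ge (f_h^{n+1},v_h-U_h^{n+1})\qquad\forall v_h\in\mathcal K_h$$ exists and is unique.
   Context: $\Omega\subset\mathbb R^2$ is an open, bounded, polygonal domain with Lipschitz boundary; $T>0$, $J=[0,T]$; $(\cdot,\cdot)$, $\|\cdot\|_0$ are the $L^2(\Omega)$ inner product and norm, $(\cdot,\cdot)_E$ the $L^2(E)$ inner product, $a^E(v,w)=\int_E\nabla v\cdot\nabla w\,dx$. $\mathcal K=\{v\in H^1_0(\Omega): v\ge0\text{ a.e.}\}$. The data satisfy $f\in C(J;L^\infty(\Omega))$, $\partial f/\partial t\in L^2(J;L^\infty(\Omega))$, $u_0\in W^{2,\infty}(\Omega)\cap\mathcal K$. Time grid: $t^n=n\Delta t$, $\Delta t=T/N$; $\partial U_h^n=(U_h^{n+1}-U_h^n)/\Delta t$. Meshes. $\Omega_h$ is a decomposition of $\Omega$ into nonoverlapping open polygons $E$ with straight edges whose closures cover $\overline\Omega$, the boundaries of two distinct elements intersecting in the empty set, in common vertices, or in shared edges. $|E|$ is the area of $E$, $h_E$ its diameter, $h=\max_Eh_E$. There is $\rho>0$ independent of $h$ such that (M1) every $E$ is star-shaped with respect to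 a ball of radius greater than $\rho h_E$; (M2) every edge of $E$ has length at least $\rho h_E$. Space. $V_h(E)=\{v_h\in H^1(E)\cap C(\overline E): v_h|_{\partial E}\in C(\partial E),\ v_h|_e\in\mathbb P_1(e)\ \forall e\subset\partial E,\ \Delta v_h=0\text{ in }E\}$; $V_h=\{v_h\in H^1_0(\Omega): v_h|_E\in V_h(E)\ \forall E\in\Omega_h\}$; $\mathcal K_h=V_h\cap\mathcal K=\{v_h\in V_h:v_h\ge0\text{ in }\Omega\}$. Projections. $\Pi^{\nabla,E}:H^1(E)\to\mathbb P_1(E)$ is defined by $(\nabla(\Pi^{\nabla,E}v-v),\nabla q)_E=0$ for all $q\in\mathbb P_1(E)$ and $\int_{\partial E}(\Pi^{\nabla,E}v-v)\,ds=0$. With $x_1,\dots,x_{N^E}$ the vertices of $E$ and $[v_h,w_h]_E=|E|\sum_{i}v_h(x_i)w_h(x_i)$, $\widetilde\Pi^E:V_h(E)\to\mathbb P_1(E)$ is defined by $[v_h-\widetilde\Pi^Ev_h,q]_E=0$ for all $q\in\mathbb P_1(E)$. Discrete forms. $m_h=\sum_Em_h^E$, $m_h^E(u_h,v_h)=(\widetilde\Pi^Eu_h,\widetilde\Pi^Ev_h)_E+S_m^E((I-\widetilde\Pi^E)u_h,(I-\widetilde\Pi^E)v_h)$, with $S_m^E$ any computable (from the degrees of freedom, i.e. the vertex values) symmetric positive definite bilinear form such that $\sigma_*(v_h,v_h)_E\le S_m^E(v_h,v_h)\le\sigma^*(v_h,v_h)_E$ on $V_h(E)\cap\ker\widetilde\Pi^E$.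 $a_h=\sum_Ea_h^E$, $a_h^E(u_h,v_h)=a^E(\Pi^{\nabla,E}u_h,\Pi^{\nabla,E}v_h)+S_a^E((I-\Pi^{\nabla,E})u_h,(I-\Pi^{\nabla,E})v_h)$, with $S_a^E$ any computable symmetric positive definite bilinear form such that $\gamma_*a^E(v_h,v_h)\le S_a^E(v_h,v_h)\le\gamma^*a^E(v_h,v_h)$ on $V_h(E)\cap\ker\Pi^{\nabla,E}$. The constants $\sigma_*,\sigma^*,\gamma_*,\gamma^*$ are positive and independent of $h$ and $E$. $(f_h^{n+1},v_h)=\sum_E(f(t^{n+1}),\widetilde\Pi^Ev_h)_E$. *)

theory Defs
  imports "HOL-Analysis.Analysis" "HOL-Probability.Essential_Supremum"
begin

section \<open>Function spaces\<close>

text \<open>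
  Lebesgue and Sobolev spaces are sets of total functions; their elements are
  representatives, and values outside the domain are irrelevant.
\<close>

definition L2 :: "'a::euclidean_space set \<Rightarrow> ('a \<Rightarrow> real) set" where
  "L2 S = {u. u \<in> borel_measurable (lebesgue_on S) \<and> integrable (lebesgue_on S) (\<lambda>x. (u x)\<^sup>2)}"

definition L2_inner :: "'a::euclidean_space set \<Rightarrow> ('a \<Rightarrow> real) \<Rightarrow> ('a \<Rightarrow> real) \<Rightarrow> real" where
  "L2_inner S u v = (\<integral>x. u x * v x \<partial>lebesgue_on S)"

definition L2_norm :: "'a::euclidean_space set \<Rightarrow> ('a \<Rightarrow> real) \<Rightarrow> real" where
  "L2_norm S u = sqrt (L2_inner S u u)"

definition Linf_norm :: "'a::euclidean_space set \<Rightarrow> ('a \<Rightarrow> real) \<Rightarrow> ennreal" where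
  "Linf_norm S u = esssup (lebesgue_on S) (\<lambda>x. ennreal \<bar>u x\<bar>)"

definition Linf :: "'a::euclidean_space set \<Rightarrow> ('a \<Rightarrow> real) set" where
  "Linf S = {u. u \<in> borel_measurable (lebesgue_on S) \<and> Linf_norm S u < \<infinity>}"

definition pd :: "'a::euclidean_space \<Rightarrow> ('a \<Rightarrow> real) \<Rightarrow> 'a \<Rightarrow> real" where
  "pd b f x = frechet_derivative f (at x) b"

fun Ck :: "nat \<Rightarrow> ('a::euclidean_space \<Rightarrow> real) \<Rightarrow> bool" where
  "Ck 0 f = continuous_on UNIV f"
| "Ck (Suc k) f = ((\<forall>x. f differentiable (at x)) \<and> (\<forall>b\<in>Basis. Ck k (pd b f)))"

text \<open>\<open>C\<^sub>c\<^sup>\<infinity>(S)\<close>, each function being extended by zero to the whole space.\<close>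

definition test_functions :: "'a::euclidean_space set \<Rightarrow> ('a \<Rightarrow> real) set" where
  "test_functions S = {\<phi>. (\<forall>k. Ck k \<phi>) \<and> compact (closure {x. \<phi> x \<noteq> 0})
                           \<and> closure {x. \<phi> x \<noteq> 0} \<subseteq> S}"

text \<open>\<open>g\<close> is the weak derivative of \<open>u\<close> in direction \<open>b\<close>; only used for locally integrable \<open>u\<close>, \<open>g\<close>.\<close>

definition weak_pd ::
  "'a::euclidean_space set \<Rightarrow> 'a \<Rightarrow> ('a \<Rightarrow> real) \<Rightarrow> ('a \<Rightarrow> real) \<Rightarrow> bool" where
  "weak_pd S b u g \<longleftrightarrow> (\<forall>\<phi>\<in>test_functions S. L2_inner S u (pd b \<phi>) = - L2_inner S g \<phi>)"

definition is_weak_grad :: "'a::euclidean_space set \<Rightarrow> ('a \<Rightarrow> real) \<Rightarrow> ('a \<Rightarrow> 'a) \<Rightarrow> bool" where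
  "is_weak_grad S u g \<longleftrightarrow>
     (\<forall>b\<in>Basis. (\<lambda>x. g x \<bullet> b) \<in> L2 S \<and> weak_pd S b u (\<lambda>x. g x \<bullet> b))"

definition H1 :: "'a::euclidean_space set \<Rightarrow> ('a \<Rightarrow> real) set" where
  "H1 S = {u \<in> L2 S. \<exists>g. is_weak_grad S u g}"

text \<open>The weak gradient is unique up to null sets, and only enters under integrals.\<close>

definition weak_grad :: "'a::euclidean_space set \<Rightarrow> ('a \<Rightarrow> real) \<Rightarrow> 'a \<Rightarrow> 'a" where
  "weak_grad S u = (SOME g. is_weak_grad S u g)"

definition grad_inner :: "'a::euclidean_space set \<Rightarrow> ('a \<Rightarrow> real) \<Rightarrow> ('a \<Rightarrow> real) \<Rightarrow> real" where
  "grad_inner S u v = (\<integral>x. weak_grad S u x \<bullet> weak_grad S v x \<partial>lebesgue_on S)"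

definition H1_norm :: "'a::euclidean_space set \<Rightarrow> ('a \<Rightarrow> real) \<Rightarrow> real" where
  "H1_norm S u = sqrt (L2_inner S u u + grad_inner S u u)"

definition H10 :: "'a::euclidean_space set \<Rightarrow> ('a \<Rightarrow> real) set" where
  "H10 S = {u \<in> H1 S. \<exists>\<phi>. (\<forall>k. \<phi> k \<in> test_functions S)
                       \<and> (\<lambda>k::nat. H1_norm S (\<lambda>x. u x - \<phi> k x)) \<longlonglongrightarrow> 0}"

fun Wkinf :: "nat \<Rightarrow> 'a::euclidean_space set \<Rightarrow> ('a \<Rightarrow> real) set" where
  "Wkinf 0 S = Linf S"
| "Wkinf (Suc k) S = {u \<in> Linf S. \<forall>b\<in>Basis. \<exists>g\<in>Wkinf k S. weak_pd S b u g}"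

text \<open>\<open>\<Delta>v = 0\<close> in \<open>S\<close> in the sense of distributions.\<close>

definition weakly_harmonic :: "'a::euclidean_space set \<Rightarrow> ('a \<Rightarrow> real) \<Rightarrow> bool" where
  "weakly_harmonic S v \<longleftrightarrow>
     (\<forall>\<phi>\<in>test_functions S. L2_inner S v (\<lambda>x. \<Sum>b\<in>Basis. pd b (pd b \<phi>) x) = 0)"

definition obstacle_cone :: "'a::euclidean_space set \<Rightarrow> ('a \<Rightarrow> real) set" where
  "obstacle_cone S = {v \<in> H10 S. AE x in lebesgue_on S. 0 \<le> v x}"


section \<open>Functions of time with values in \<open>L\<^sup>\<infinity>\<close>\<close>

text \<open>
  \<open>L\<^sup>\<infinity>\<close> is not separable, so the library's Bochner integral does not apply; strong
  measurability and the Bochner integral are defined through simple functions.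
\<close>

definition C_Linf :: "real set \<Rightarrow> 'a::euclidean_space set \<Rightarrow> (real \<Rightarrow> 'a \<Rightarrow> real) set" where
  "C_Linf J S = {f. \<forall>t\<in>J. f t \<in> Linf S
                   \<and> ((\<lambda>s. Linf_norm S (\<lambda>x. f s x - f t x)) \<longlongrightarrow> 0) (at t within J)}"

definition simple_Linf :: "real set \<Rightarrow> 'a::euclidean_space set \<Rightarrow> (real \<Rightarrow> 'a \<Rightarrow> real) set" where
  "simple_Linf J S = {s. \<exists>(m::nat) A c.
      (\<forall>i<m. A i \<in> sets (lebesgue_on J) \<and> c i \<in> Linf S)
      \<and> s = (\<lambda>t x. \<Sum>i<m. indicator (A i) t * c i x)}"

definition strongly_approx ::
  "real set \<Rightarrow> 'a::euclidean_space set \<Rightarrow> (nat \<Rightarrow> real \<Rightarrow> 'a \<Rightarrow> real) \<Rightarrow> (real \<Rightarrow> 'a \<Rightarrow> real) \<Rightarrow> bool" where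
  "strongly_approx J S s g \<longleftrightarrow> (\<forall>k. s k \<in> simple_Linf J S)
     \<and> (AE t in lebesgue_on J. g t \<in> Linf S \<and> (\<lambda>k. Linf_norm S (\<lambda>x. s k t x - g t x)) \<longlonglongrightarrow> 0)"

text \<open>For simple \<open>s\<close> the Bochner integral is the pointwise-in-\<open>x\<close> integral \<open>\<lambda>x. \<integral>t. s t x\<close>.\<close>

definition has_bochner_Linf ::
  "real set \<Rightarrow> 'a::euclidean_space set \<Rightarrow> (real \<Rightarrow> 'a \<Rightarrow> real) \<Rightarrow> ('a \<Rightarrow> real) \<Rightarrow> bool" where
  "has_bochner_Linf J S g I \<longleftrightarrow> I \<in> Linf S \<and> (\<exists>s. strongly_approx J S s g
     \<and> (\<lambda>k. \<integral>\<^sup>+t. Linf_norm S (\<lambda>x. s k t x - g t x) \<partial>lebesgue_on J) \<longlonglongrightarrow> 0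
     \<and> (\<lambda>k. Linf_norm S (\<lambda>x. (\<integral>t. s k t x \<partial>lebesgue_on J) - I x)) \<longlonglongrightarrow> 0)"

definition L2_Linf :: "real set \<Rightarrow> 'a::euclidean_space set \<Rightarrow> (real \<Rightarrow> 'a \<Rightarrow> real) set" where
  "L2_Linf J S = {g. (\<exists>s. strongly_approx J S s g)
                    \<and> (\<integral>\<^sup>+t. (Linf_norm S (g t))\<^sup>2 \<partial>lebesgue_on J) < \<infinity>}"

definition weak_time_deriv ::
  "real set \<Rightarrow> 'a::euclidean_space set \<Rightarrow> (real \<Rightarrow> 'a \<Rightarrow> real) \<Rightarrow> (real \<Rightarrow> 'a \<Rightarrow> real) \<Rightarrow> bool" where
  "weak_time_deriv J S f g \<longleftrightarrow> (\<forall>\<phi>\<in>test_functions (interior J). \<exists>I.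
      has_bochner_Linf J S (\<lambda>t x. pd 1 \<phi> t * f t x) I
      \<and> has_bochner_Linf J S (\<lambda>t x. \<phi> t * g t x) (\<lambda>x. - I x))"


section \<open>Polygonal domains and meshes\<close>

definition lipschitz_boundary :: "(real^2) set \<Rightarrow> bool" where
  "lipschitz_boundary S \<longleftrightarrow> (\<forall>x\<in>frontier S. \<exists>r>0. \<exists>(R::real^2 \<Rightarrow> real^2) L (\<gamma>::real \<Rightarrow> real).
      orthogonal_transformation R \<and> L-lipschitz_on UNIV \<gamma>
      \<and> (\<forall>y\<in>ball x r. y \<in> S \<longleftrightarrow> \<gamma> (R y $ 1) < R y $ 2))"

definition polygonal_lipschitz_domain :: "(real^2) set \<Rightarrow> bool" where
  "polygonal_lipschitz_domain S \<longleftrightarrow>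
     open S \<and> connected S \<and> bounded S \<and> S \<noteq> {}
     \<and> (\<exists>F. finite F \<and> frontier S = (\<Union>(a, b)\<in>F. closed_segment a b))
     \<and> lipschitz_boundary S"

text \<open>
  A polygon is given by the cyclic list of its vertices. Straight angles are allowed, so that
  hanging nodes are vertices and the edges are the segments between consecutive list entries.
\<close>

type_synonym polygon = "(real^2) list"

definition next_vertex :: "polygon \<Rightarrow> nat \<Rightarrow> real^2" where
  "next_vertex P i = P ! (Suc i mod length P)"

definition edge :: "polygon \<Rightarrow> nat \<Rightarrow> (real^2) set" where
  "edge P i = closed_segment (P ! i) (next_vertex P i)"

definition edges :: "polygon \<Rightarrow> (real^2) set set" where
  "edges P = edge P ` {..<length P}"

definition simple_polygon :: "polygon \<Rightarrow> bool" where
  "simple_polygon P \<longleftrightarrow> 3 \<le> length P \<and> distinct P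
     \<and> (\<forall>i<length P. \<forall>j<length P. i \<noteq> j \<longrightarrow>
          edge P i \<inter> edge P j = {P ! i, next_vertex P i} \<inter> {P ! j, next_vertex P j})"

text \<open>The open polygon \<open>E\<close>: the bounded component of the complement of the boundary curve.\<close>

definition region :: "polygon \<Rightarrow> (real^2) set" where
  "region P = inside (\<Union>(edges P))"

definition area :: "polygon \<Rightarrow> real" where
  "area P = measure lebesgue (region P)"

definition star_shaped_wrt_ball :: "(real^2) set \<Rightarrow> real \<Rightarrow> bool" where
  "star_shaped_wrt_ball S r \<longleftrightarrow>
     (\<exists>c. ball c r \<subseteq> S \<and> (\<forall>y\<in>ball c r. \<forall>x\<in>S. closed_segment y x \<subseteq> S))"

definition polygonal_mesh :: "(real^2) set \<Rightarrow> polygon set \<Rightarrow> bool" where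
  "polygonal_mesh \<Omega> M \<longleftrightarrow> finite M
     \<and> (\<forall>P\<in>M. simple_polygon P \<and> region P \<subseteq> \<Omega>)
     \<and> (\<Union>P\<in>M. closure (region P)) = closure \<Omega>
     \<and> (\<forall>P\<in>M. \<forall>Q\<in>M. P \<noteq> Q \<longrightarrow> region P \<inter> region Q = {}
          \<and> frontier (region P) \<inter> frontier (region Q)
              = (set P \<inter> set Q) \<union> \<Union>(edges P \<inter> edges Q))"

definition mesh_size :: "polygon set \<Rightarrow> real" where
  "mesh_size M = Max ((\<lambda>P. diameter (region P)) ` M)"

definition mesh_regular :: "real \<Rightarrow> polygon set \<Rightarrow> bool" where
  "mesh_regular \<rho> M \<longleftrightarrow> (\<forall>P\<in>M.
     (\<exists>r > \<rho> * diameter (region P). star_shaped_wrt_ball (region P) r)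
     \<and> (\<forall>i<length P. \<rho> * diameter (region P) \<le> dist (P ! i) (next_vertex P i)))"


section \<open>The virtual element space\<close>

definition P1 :: "(real^2 \<Rightarrow> real) set" where
  "P1 = {q. \<exists>c g. q = (\<lambda>x. c + g \<bullet> x)}"

definition Vh_loc :: "polygon \<Rightarrow> (real^2 \<Rightarrow> real) set" where
  "Vh_loc P = {v. v \<in> H1 (region P) \<and> continuous_on (closure (region P)) v
     \<and> (\<forall>e\<in>edges P. \<exists>q\<in>P1. \<forall>x\<in>e. v x = q x)
     \<and> weakly_harmonic (region P) v}"

text \<open>
  The elements of \<open>Vh\<close> are the representatives that are continuous on the closed elements,
  hence on \<open>closure \<Omega>\<close>; as total functions they are set to zero elsewhere. Thus equality
  in \<open>Vh\<close> is equality of functions.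
\<close>

definition Vh :: "(real^2) set \<Rightarrow> polygon set \<Rightarrow> (real^2 \<Rightarrow> real) set" where
  "Vh \<Omega> M = {v \<in> H10 \<Omega>. (\<forall>P\<in>M. v \<in> Vh_loc P) \<and> (\<forall>x. x \<notin> closure \<Omega> \<longrightarrow> v x = 0)}"

definition Kh :: "(real^2) set \<Rightarrow> polygon set \<Rightarrow> (real^2 \<Rightarrow> real) set" where
  "Kh \<Omega> M = Vh \<Omega> M \<inter> obstacle_cone \<Omega>"


section \<open>Projections\<close>

text \<open>Arc-length integral over the boundary.\<close>

definition boundary_integral :: "polygon \<Rightarrow> (real^2 \<Rightarrow> real) \<Rightarrow> real" where
  "boundary_integral P v = (\<Sum>i<length P. dist (P ! i) (next_vertex P i)
       * integral {0..1} (\<lambda>t. v (linepath (P ! i) (next_vertex P i) t)))"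

text \<open>
  For \<open>v \<in> H1 (region P)\<close> continuous up to the boundary, in particular for
  \<open>v \<in> Vh_loc P\<close>, the trace in the boundary condition is the restriction of \<open>v\<close>.
\<close>

definition proj_grad :: "polygon \<Rightarrow> (real^2 \<Rightarrow> real) \<Rightarrow> real^2 \<Rightarrow> real" where
  "proj_grad P v = (THE p. p \<in> P1
     \<and> (\<forall>q\<in>P1. grad_inner (region P) (\<lambda>x. p x - v x) q = 0)
     \<and> boundary_integral P (\<lambda>x. p x - v x) = 0)"

definition vertex_inner :: "polygon \<Rightarrow> (real^2 \<Rightarrow> real) \<Rightarrow> (real^2 \<Rightarrow> real) \<Rightarrow> real" where
  "vertex_inner P v w = area P * (\<Sum>i<length P. v (P ! i) * w (P ! i))"

definition proj_vertex :: "polygon \<Rightarrow> (real^2 \<Rightarrow> real) \<Rightarrow> real^2 \<Rightarrow> real" where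
  "proj_vertex P v = (THE p. p \<in> P1 \<and> (\<forall>q\<in>P1. vertex_inner P (\<lambda>x. v x - p x) q = 0))"


section \<open>Discrete forms\<close>

type_synonym form = "(real^2 \<Rightarrow> real) \<Rightarrow> (real^2 \<Rightarrow> real) \<Rightarrow> real"

text \<open>The last condition says that the value depends on the vertex values of the arguments only.\<close>

definition computable_spd :: "polygon \<Rightarrow> form \<Rightarrow> bool" where
  "computable_spd P S \<longleftrightarrow>
     (\<forall>u\<in>Vh_loc P. \<forall>v\<in>Vh_loc P. \<forall>w\<in>Vh_loc P. \<forall>a b.
        S (\<lambda>x. a * u x + b * v x) w = a * S u w + b * S v w)
     \<and> (\<forall>u\<in>Vh_loc P. \<forall>v\<in>Vh_loc P. S u v = S v u)
     \<and> (\<forall>v\<in>Vh_loc P. (\<exists>x\<in>region P. v x \<noteq> 0) \<longrightarrow> 0 < S v v)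
     \<and> (\<forall>u\<in>Vh_loc P. \<forall>u'\<in>Vh_loc P. \<forall>v\<in>Vh_loc P. \<forall>v'\<in>Vh_loc P.
          (\<forall>x\<in>set P. u x = u' x \<and> v x = v' x) \<longrightarrow> S u v = S u' v')"

definition mass_stabilization :: "real \<Rightarrow> real \<Rightarrow> polygon \<Rightarrow> form \<Rightarrow> bool" where
  "mass_stabilization c C P S \<longleftrightarrow> computable_spd P S
     \<and> (\<forall>v\<in>Vh_loc P. proj_vertex P v = (\<lambda>x. 0) \<longrightarrow>
          c * L2_inner (region P) v v \<le> S v v \<and> S v v \<le> C * L2_inner (region P) v v)"

definition stiffness_stabilization :: "real \<Rightarrow> real \<Rightarrow> polygon \<Rightarrow> form \<Rightarrow> bool" where
  "stiffness_stabilization c C P S \<longleftrightarrow> computable_spd P S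
     \<and> (\<forall>v\<in>Vh_loc P. proj_grad P v = (\<lambda>x. 0) \<longrightarrow>
          c * grad_inner (region P) v v \<le> S v v \<and> S v v \<le> C * grad_inner (region P) v v)"

definition mh :: "polygon set \<Rightarrow> (polygon \<Rightarrow> form) \<Rightarrow> form" where
  "mh M Sm u v = (\<Sum>P\<in>M. L2_inner (region P) (proj_vertex P u) (proj_vertex P v)
      + Sm P (\<lambda>x. u x - proj_vertex P u x) (\<lambda>x. v x - proj_vertex P v x))"

definition ah :: "polygon set \<Rightarrow> (polygon \<Rightarrow> form) \<Rightarrow> form" where
  "ah M Sa u v = (\<Sum>P\<in>M. grad_inner (region P) (proj_grad P u) (proj_grad P v)
      + Sa P (\<lambda>x. u x - proj_grad P u x) (\<lambda>x. v x - proj_grad P v x))"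

definition load :: "polygon set \<Rightarrow> (real^2 \<Rightarrow> real) \<Rightarrow> (real^2 \<Rightarrow> real) \<Rightarrow> real" where
  "load M g v = (\<Sum>P\<in>M. L2_inner (region P) g (proj_vertex P v))"

text \<open>\<open>W\<close> solves one step of length \<open>\<tau>\<close> from \<open>U\<close>, where \<open>g\<close> is the load at the new time.\<close>

definition vem_step ::
  "(real^2) set \<Rightarrow> polygon set \<Rightarrow> (polygon \<Rightarrow> form) \<Rightarrow> (polygon \<Rightarrow> form) \<Rightarrow> real
   \<Rightarrow> (real^2 \<Rightarrow> real) \<Rightarrow> (real^2 \<Rightarrow> real) \<Rightarrow> (real^2 \<Rightarrow> real) \<Rightarrow> bool" where
  "vem_step \<Omega> M Sm Sa \<tau> g U W \<longleftrightarrow> W \<in> Kh \<Omega> M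
     \<and> (\<forall>v\<in>Kh \<Omega> M. mh M Sm (\<lambda>x. (W x - U x) / \<tau>) (\<lambda>x. v x - W x) + ah M Sa W (\<lambda>x. v x - W x)
                      \<ge> load M g (\<lambda>x. v x - W x))"

end

theory Submission
  imports Defs
begin

text \<open>
  One implicit step is a variational inequality on the closed convex cone \<open>Kh\<close> of a
  finite-dimensional space, and its bilinear form \<open>mh / \<tau> + ah\<close> is an inner product on \<open>Vh\<close>;
  so the unique solution is the projection of the Riesz representative of the right-hand side
  onto \<open>Kh\<close>.  Three facts carry this argument.

  \<^emph>\<open>Finite dimension.\<close>  A function of \<open>Vh\<close> that vanishes at all vertices of the mesh is zero.
  For harmonic functions this is the maximum principle, but the stabilization already contains it:
  its value depends on the vertex values only, so vanishing vertex values give \<open>S v v = S 0 0 = 0\<close>,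
  and positivity of \<open>S\<close> makes \<open>v\<close> vanish in the element.  The function space is then separated by
  finitely many point evaluations, and Gram-Schmidt along these points yields an orthonormal basis
  (\<open>orthonormal_basis_exists\<close>).

  \<^emph>\<open>Definiteness.\<close>  If \<open>mh v v = 0\<close>, then on every element both the affine part \<open>proj_vertex P v\<close>
  and the remainder vanish, so \<open>v\<close> is zero in every element and, by continuity, on the closure of
  the domain (\<open>mh_loc_definite\<close>, \<open>Vh_eq_0\<close>).  The form \<open>ah\<close> only has to be nonnegative.

  \<^emph>\<open>Linearity.\<close>  The forms are bilinear because both projections are linear, and \<open>Vh\<close> is a linear
  space because weak gradients are additive.  Weak gradients enter as arbitrarily chosen
  representatives, so everything rests on their uniqueness up to null sets, that is, on the
  fundamental lemma of the calculus of variations (\<open>fundamental_lemma_of_variations\<close>).  The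
  remainders of the projections stay in the local spaces because affine functions belong to them,
  which is integration by parts against test functions (\<open>smooth_weak_pd\<close>, \<open>weakly_harmonic_affine\<close>).

  The abstract existence and uniqueness result is \<open>variational_inequality_ex1\<close>; its application
  to one time step is \<open>vem_step_ex1\<close>.
\<close>

section \<open>Smooth functions and test functions\<close>

definition smooth :: "('a::euclidean_space \<Rightarrow> real) \<Rightarrow> bool" where
  "smooth f \<longleftrightarrow> (\<forall>k. Ck k f)"

lemma pd_eq_derivative: "(f has_derivative f') (at x) \<Longrightarrow> pd b f x = f' b"
  by (simp add: pd_def frechet_derivative_at[symmetric])

lemma pd_const: "pd b (\<lambda>x. c) = (\<lambda>x. 0)"
  by (rule ext, rule pd_eq_derivative[where f' = "\<lambda>x. 0"]) (auto intro!: derivative_eq_intros)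

lemma pd_affine: "pd b (\<lambda>x. c + w \<bullet> x) = (\<lambda>x. w \<bullet> b)"
  by (rule ext, rule pd_eq_derivative) (auto intro!: derivative_eq_intros)

lemma pd_add:
  assumes "f differentiable (at x)" "g differentiable (at x)"
  shows "pd b (\<lambda>x. f x + g x) x = pd b f x + pd b g x"
  unfolding pd_def
  by (subst frechet_derivative_at[symmetric, OF has_derivative_add])
     (use assms in \<open>auto simp: frechet_derivative_works\<close>)

lemma pd_mult:
  assumes "f differentiable (at x)" "g differentiable (at x)"
  shows "pd b (\<lambda>x. f x * g x) x = f x * pd b g x + pd b f x * g x"
  unfolding pd_def
  by (subst frechet_derivative_at[symmetric, OF has_derivative_mult])
     (use assms in \<open>auto simp: frechet_derivative_works\<close>)

lemma Ck_SucD: "Ck (Suc k) f \<Longrightarrow> Ck k f"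
proof (induction k arbitrary: f)
  case 0
  then have "continuous (at x) f" for x
    by (simp add: differentiable_imp_continuous_within)
  then show ?case by (simp add: continuous_at_imp_continuous_on)
qed simp

lemma Ck_const: "Ck k (\<lambda>x. c)"
  by (induction k arbitrary: c) (auto simp: pd_const)

lemma Ck_affine: "Ck k (\<lambda>x. c + w \<bullet> x)"
  by (cases k) (auto simp: pd_affine Ck_const intro!: continuous_intros derivative_intros)

lemma Ck_add: "Ck k f \<Longrightarrow> Ck k g \<Longrightarrow> Ck k (\<lambda>x. f x + g x)"
proof (induction k arbitrary: f g)
  case (Suc k)
  then have "pd b (\<lambda>x. f x + g x) = (\<lambda>x. pd b f x + pd b g x)" for b
    by (auto simp: pd_add)
  then show ?case using Suc by (auto intro: derivative_intros)
qed (auto intro: continuous_intros)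

lemma Ck_mult: "Ck k f \<Longrightarrow> Ck k g \<Longrightarrow> Ck k (\<lambda>x. f x * g x)"
proof (induction k arbitrary: f g)
  case (Suc k)
  then have "pd b (\<lambda>x. f x * g x) = (\<lambda>x. f x * pd b g x + pd b f x * g x)" for b
    by (auto simp: pd_mult)
  moreover have "Ck k f" "Ck k g" using Suc.prems Ck_SucD by blast+
  ultimately show ?case using Suc.prems
    by (auto intro!: derivative_intros Ck_add Suc.IH)
qed (auto intro: continuous_intros)

lemma smooth_differentiable: "smooth f \<Longrightarrow> f differentiable (at x)"
  unfolding smooth_def using Ck.simps(2) by blast

lemma smooth_continuous: "smooth f \<Longrightarrow> continuous_on A f"
  unfolding smooth_def using Ck.simps(1) continuous_on_subset by blast

lemma smooth_pd: "smooth f \<Longrightarrow> b \<in> Basis \<Longrightarrow> smooth (pd b f)"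
  unfolding smooth_def using Ck.simps(2) by blast

lemma smooth_const: "smooth (\<lambda>x. c)"
  by (simp add: smooth_def Ck_const)

lemma smooth_affine: "smooth (\<lambda>x. c + w \<bullet> x)"
  by (simp add: smooth_def Ck_affine)

lemma smooth_add: "smooth f \<Longrightarrow> smooth g \<Longrightarrow> smooth (\<lambda>x. f x + g x)"
  by (simp add: smooth_def Ck_add)

lemma smooth_mult: "smooth f \<Longrightarrow> smooth g \<Longrightarrow> smooth (\<lambda>x. f x * g x)"
  by (simp add: smooth_def Ck_mult)

lemma smooth_lincomb: "smooth f \<Longrightarrow> smooth g \<Longrightarrow> smooth (\<lambda>x. a * f x + b * g x)"
  by (simp add: smooth_add smooth_mult smooth_const)

lemma smooth_prod:
  "finite I \<Longrightarrow> (\<And>i. i \<in> I \<Longrightarrow> smooth (f i)) \<Longrightarrow> smooth (\<lambda>x. \<Prod>i\<in>I. f i x)"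
  by (induction I rule: finite_induct) (auto simp: smooth_const intro: smooth_mult)

text \<open>
  The derivative of \<open>p(1/t) exp(-1/t)\<close> has the same form with another polynomial.  Admitting all
  polynomials \<open>p\<close> therefore turns the smoothness of \<open>exp(-1/t)\<close> into a plain induction.
\<close>

definition flat_exp :: "real poly \<Rightarrow> real \<Rightarrow> real" where
  "flat_exp p t = (if t \<le> 0 then 0 else poly p (1/t) * exp (- 1/t))"

lemma poly_times_exp_minus_tendsto_0: "((\<lambda>s. poly p s * exp (- s)) \<longlongrightarrow> (0::real)) at_top"
proof -
  have "((\<lambda>s. \<Sum>i\<le>degree p. coeff p i * (s ^ i / exp s)) \<longlongrightarrow> (\<Sum>i\<le>degree p. coeff p i * 0)) at_top"
    by (intro tendsto_intros tendsto_power_div_exp_0)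
  moreover have "(\<lambda>s. \<Sum>i\<le>degree p. coeff p i * (s ^ i / exp s)) = (\<lambda>s. poly p s * exp (- s))"
    by (rule ext) (simp add: poly_altdef sum_distrib_right exp_minus divide_inverse mult.assoc)
  ultimately show ?thesis by simp
qed

text \<open>
  With \<open>s = 1/t\<close> the chain rule gives \<open>- s\<^sup>2 (p(s) exp(-s))' = s\<^sup>2 (p(s) - p'(s)) exp(-s)\<close>, which
  explains the polynomial on the right.  At the origin the difference quotient from the right is
  \<open>s p(s) exp(-s)\<close> with \<open>s\<close> tending to infinity.
\<close>

lemma flat_exp_has_derivative:
  "(flat_exp p has_real_derivative flat_exp (monom 1 2 * (p - pderiv p)) t) (at t)"
proof -
  consider "t < 0" | "t > 0" | "t = 0" by linarith
  then show ?thesis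
  proof cases
    case 1
    have "(flat_exp p has_real_derivative 0) (at t)"
      by (rule has_field_derivative_transform_within_open[where f = "\<lambda>_. 0" and S = "{..<0}"])
         (use 1 in \<open>auto simp: flat_exp_def\<close>)
    then show ?thesis using 1 by (simp add: flat_exp_def)
  next
    case 2
    have "((\<lambda>t. poly p (1/t) * exp (- 1/t)) has_real_derivative
        flat_exp (monom 1 2 * (p - pderiv p)) t) (at t)"
      using 2 by (auto intro!: derivative_eq_intros DERIV_chain2[OF poly_DERIV]
          simp: flat_exp_def poly_monom power2_eq_square field_simps)
    then show ?thesis
      by (rule has_field_derivative_transform_within_open[where S = "{0<..}"])
         (use 2 in \<open>auto simp: flat_exp_def\<close>)
  next
    case 3
    have "((\<lambda>h. flat_exp p h / h) \<longlongrightarrow> 0) (at_left 0)"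
      by (rule tendsto_eventually) (auto simp: flat_exp_def eventually_at_filter)
    moreover have "((\<lambda>h. flat_exp p h / h) \<longlongrightarrow> 0) (at_right 0)"
    proof -
      have "((\<lambda>h. poly (monom 1 1 * p) (inverse h) * exp (- inverse h)) \<longlongrightarrow> 0) (at_right 0)"
        by (rule filterlim_compose[OF poly_times_exp_minus_tendsto_0
              filterlim_inverse_at_top_right])
      then show ?thesis
        by (rule Lim_transform_eventually)
           (auto simp: flat_exp_def eventually_at_filter poly_monom field_simps)
    qed
    ultimately have "((\<lambda>h. flat_exp p h / h) \<longlongrightarrow> 0) (at 0)"
      by (simp add: filterlim_split_at)
    then show ?thesis using 3 by (simp add: DERIV_def flat_exp_def)
  qed
qed

lemma smooth_flat_exp_affine: "smooth (\<lambda>x. flat_exp p (c + w \<bullet> x))"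
proof -
  have "Ck k (\<lambda>x. flat_exp p (c + w \<bullet> x))" for k
  proof (induction k arbitrary: p)
    case 0
    have "continuous_on UNIV (flat_exp p)"
      using flat_exp_has_derivative
      by (meson DERIV_isCont continuous_at_imp_continuous_on)
    then show ?case
      by (auto intro!: continuous_on_compose2[of UNIV "flat_exp p"] continuous_intros)
  next
    case (Suc k)
    let ?q = "monom 1 2 * (p - pderiv p)"
    have der: "((\<lambda>x. flat_exp p (c + w \<bullet> x)) has_derivative
        (\<lambda>h. flat_exp ?q (c + w \<bullet> x) * (w \<bullet> h))) (at x)" for x
    proof -
      have "((\<lambda>x. c + w \<bullet> x) has_derivative (\<lambda>h. w \<bullet> h)) (at x)"
        by (auto intro!: derivative_eq_intros)
      from has_derivative_compose[OF this
          flat_exp_has_derivative[of p "c + w \<bullet> x", unfolded has_field_derivative_def]]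
      show ?thesis .
    qed
    have "pd b (\<lambda>x. flat_exp p (c + w \<bullet> x)) = (\<lambda>x. flat_exp ?q (c + w \<bullet> x) * (w \<bullet> b))" for b
      by (rule ext) (rule pd_eq_derivative[OF der])
    moreover have "(\<lambda>x. flat_exp p (c + w \<bullet> x)) differentiable (at x)" for x
      using der differentiable_def by blast
    ultimately show ?case by (simp add: Suc Ck_mult Ck_const)
  qed
  then show ?thesis by (simp add: smooth_def)
qed

text \<open>
  Any compact set outside of which the function vanishes can replace the support; this and the
  converse below spare all later arguments the closure in the definition.
\<close>

lemma test_functionsI:
  "smooth \<phi> \<Longrightarrow> compact K \<Longrightarrow> K \<subseteq> S \<Longrightarrow> (\<And>x. x \<notin> K \<Longrightarrow> \<phi> x = 0) \<Longrightarrow> \<phi> \<in> test_functions S"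
proof -
  assume a: "smooth \<phi>" "compact K" "K \<subseteq> S" "\<And>x. x \<notin> K \<Longrightarrow> \<phi> x = 0"
  have "closure {x. \<phi> x \<noteq> 0} \<subseteq> K"
    using a(2,4) by (intro closure_minimal) (auto intro: compact_imp_closed)
  then show ?thesis using a unfolding test_functions_def smooth_def
    by (auto intro: compact_closure[THEN iffD2] bounded_subset[OF compact_imp_bounded]
        dest: closure_subset[THEN subsetD])
qed

lemma test_functionsE:
  assumes "\<phi> \<in> test_functions S"
  obtains K where "smooth \<phi>" "compact K" "K \<subseteq> S" "\<And>x. x \<notin> K \<Longrightarrow> \<phi> x = 0"
  using assms closure_subset[of "{x. \<phi> x \<noteq> 0}"]
  unfolding test_functions_def smooth_def by blast

lemma test_functions_mult:
  "smooth q \<Longrightarrow> \<phi> \<in> test_functions S \<Longrightarrow> (\<lambda>x. q x * \<phi> x) \<in> test_functions S"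
  by (erule test_functionsE, rule test_functionsI) (auto intro: smooth_mult)

lemma test_functions_lincomb:
  assumes "\<phi> \<in> test_functions S" "\<psi> \<in> test_functions S"
  shows "(\<lambda>x. a * \<phi> x + b * \<psi> x) \<in> test_functions S"
proof -
  obtain K L where "smooth \<phi>" "compact K" "K \<subseteq> S" "\<And>x. x \<notin> K \<Longrightarrow> \<phi> x = 0"
    "smooth \<psi>" "compact L" "L \<subseteq> S" "\<And>x. x \<notin> L \<Longrightarrow> \<psi> x = 0"
    using assms test_functionsE by metis
  then show ?thesis
    by (intro test_functionsI[where K = "K \<union> L"]) (auto intro: smooth_lincomb)
qed

lemma test_functions_zero: "(\<lambda>x. 0) \<in> test_functions S"
  by (rule test_functionsI[where K = "{}"]) (auto simp: smooth_const)

lemma test_functions_pd: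
  assumes "\<phi> \<in> test_functions S" "b \<in> Basis"
  shows "pd b \<phi> \<in> test_functions S"
proof -
  obtain K where K: "smooth \<phi>" "compact K" "K \<subseteq> S" "\<And>x. x \<notin> K \<Longrightarrow> \<phi> x = 0"
    using assms test_functionsE by metis
  have "pd b \<phi> x = 0" if "x \<notin> K" for x
  proof -
    have "(\<phi> has_derivative (\<lambda>h. 0)) (at x)"
      by (rule has_derivative_transform_within_open[where f = "\<lambda>_. 0" and s = "- K"])
         (use K that in \<open>auto intro: compact_imp_closed\<close>)
    then show ?thesis by (rule pd_eq_derivative)
  qed
  then show ?thesis using K assms by (intro test_functionsI[of _ K]) (auto intro: smooth_pd)
qed

lemma test_functions_bounded:
  assumes "\<phi> \<in> test_functions S"
  obtains C where "\<And>x. \<bar>\<phi> x\<bar> \<le> C"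
proof -
  obtain K where K: "smooth \<phi>" "compact K" "\<And>x. x \<notin> K \<Longrightarrow> \<phi> x = 0"
    using assms test_functionsE by metis
  then have "bounded (\<phi> ` K)"
    by (intro compact_imp_bounded compact_continuous_image smooth_continuous)
  then obtain C where "\<And>x. x \<in> K \<Longrightarrow> \<bar>\<phi> x\<bar> \<le> C" "0 < C"
    unfolding bounded_pos by auto
  then have "\<bar>\<phi> x\<bar> \<le> C" for x using K(3)[of x] by (cases "x \<in> K") auto
  then show ?thesis using that by blast
qed

lemma test_functions_integrable:
  assumes "\<phi> \<in> test_functions S"
  shows "integrable lborel \<phi>"
proof -
  obtain K where K: "smooth \<phi>" "compact K" "\<And>x. x \<notin> K \<Longrightarrow> \<phi> x = 0"
    using assms test_functionsE by metis
  have "integrable lborel (\<lambda>x. indicator K x *\<^sub>R \<phi> x)"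
    by (intro borel_integrable_compact smooth_continuous K)
  moreover have "(\<lambda>x. indicator K x *\<^sub>R \<phi> x) = \<phi>"
    using K(3) by (intro ext) (auto simp: indicator_def)
  ultimately show ?thesis by simp
qed

lemma integral_test_function:
  assumes "open S" "\<phi> \<in> test_functions S"
  shows "(\<integral>x. \<phi> x \<partial>lebesgue_on S) = (\<integral>x. \<phi> x \<partial>lborel)"
proof -
  obtain K where K: "smooth \<phi>" "K \<subseteq> S" "\<And>x. x \<notin> K \<Longrightarrow> \<phi> x = 0"
    using assms test_functionsE by metis
  then have "\<phi> = (\<lambda>x. if x \<in> S then \<phi> x else 0)" by (intro ext) auto
  then have "(\<integral>x. \<phi> x \<partial>lebesgue_on S) = (\<integral>x. \<phi> x \<partial>lebesgue)"
    using Lebesgue_Measure.integral_restrict_UNIV[of S \<phi>] assms(1) by simp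
  also have "\<dots> = (\<integral>x. \<phi> x \<partial>lborel)"
    using smooth_continuous[OF K(1), of UNIV]
    by (intro integral_completion) (simp add: borel_measurable_continuous_onI)
  finally show ?thesis .
qed

text \<open>
  Integrals are invariant under translation, so the difference quotients of \<open>\<phi>\<close> in direction \<open>b\<close>
  have integral zero.  They converge to the derivative, dominated by its bound on a fixed ball.
\<close>

lemma integral_pd_test_function:
  assumes "\<phi> \<in> test_functions S" "b \<in> Basis"
  shows "(\<integral>x. pd b \<phi> x \<partial>lborel) = 0"
proof -
  obtain K where K: "smooth \<phi>" "compact K" "K \<subseteq> S" "\<And>x. x \<notin> K \<Longrightarrow> \<phi> x = 0"
    using assms test_functionsE by metis
  obtain C where C: "\<And>x. \<bar>pd b \<phi> x\<bar> \<le> C"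
    using test_functions_bounded[OF test_functions_pd[OF assms]] by blast
  obtain R where R: "\<And>x. x \<in> K \<Longrightarrow> norm x \<le> R"
    using compact_imp_bounded[OF K(2)] unfolding bounded_iff by blast
  have line: "((\<lambda>s. \<phi> (x + s *\<^sub>R b)) has_real_derivative pd b \<phi> (x + s *\<^sub>R b)) (at s)" for x s
  proof -
    have "(\<phi> has_derivative frechet_derivative \<phi> (at (x + s *\<^sub>R b))) (at (x + s *\<^sub>R b))"
      using smooth_differentiable[OF K(1)] frechet_derivative_works by blast
    moreover have "((\<lambda>s. x + s *\<^sub>R b) has_derivative (\<lambda>h. h *\<^sub>R b)) (at s)"
      by (auto intro!: derivative_eq_intros)
    ultimately have "((\<lambda>s. \<phi> (x + s *\<^sub>R b)) has_derivative
        (\<lambda>h. frechet_derivative \<phi> (at (x + s *\<^sub>R b)) (h *\<^sub>R b))) (at s)"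
      by (rule has_derivative_compose[rotated])
    moreover have "frechet_derivative \<phi> (at (x + s *\<^sub>R b)) (h *\<^sub>R b) = pd b \<phi> (x + s *\<^sub>R b) * h" for h
      using linear_frechet_derivative[OF smooth_differentiable[OF K(1)]]
      by (simp add: pd_def linear_scale)
    ultimately show ?thesis by (simp add: has_field_derivative_def)
  qed
  define q where "q n x = (\<phi> (inverse (Suc n) *\<^sub>R b + x) - \<phi> x) * Suc n" for n :: nat and x
  note int = test_functions_integrable[OF assms(1)]
  have shift: "integrable lborel (\<lambda>x. \<phi> (c + x))"
       "(\<integral>x. \<phi> (c + x) \<partial>lborel) = (\<integral>x. \<phi> x \<partial>lborel)" for c
  proof -
    have m: "\<phi> \<in> borel_measurable borel" using int by auto
    show "integrable lborel (\<lambda>x. \<phi> (c + x))"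
      using int integrable_distr_eq[of "(+) c" lborel borel \<phi>] m lborel_distr_plus[of c] by simp
    show "(\<integral>x. \<phi> (c + x) \<partial>lborel) = (\<integral>x. \<phi> x \<partial>lborel)"
      using integral_distr[of "(+) c" lborel borel \<phi>] m lborel_distr_plus[of c] by simp
  qed
  have q0: "(\<integral>x. q n x \<partial>lborel) = 0" for n
    unfolding q_def using shift int by simp
  have "(\<lambda>n. \<integral>x. q n x \<partial>lborel) \<longlonglongrightarrow> (\<integral>x. pd b \<phi> x \<partial>lborel)"
  proof (rule integral_dominated_convergence[where w = "\<lambda>x. indicator (cball 0 (R + 1)) x *\<^sub>R C"])
    show "pd b \<phi> \<in> borel_measurable lborel"
      using test_functions_integrable[OF test_functions_pd[OF assms]] by auto
    show "q n \<in> borel_measurable lborel" for n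
      unfolding q_def using shift(1)[of "inverse (Suc n) *\<^sub>R b"] int by auto
    show "integrable lborel (\<lambda>x. indicat_real (cball 0 (R + 1)) x *\<^sub>R C)"
      by (intro borel_integrable_compact) auto
    show "AE x in lborel. (\<lambda>n. q n x) \<longlonglongrightarrow> pd b \<phi> x"
    proof (rule AE_I2)
      fix x
      have "((\<lambda>h. (\<phi> (x + h *\<^sub>R b) - \<phi> x) / h) \<longlongrightarrow> pd b \<phi> x) (at 0)"
        using line[of x 0] by (simp add: DERIV_def)
      moreover have "filterlim (\<lambda>n. inverse (real (Suc n))) (at 0) sequentially"
        using LIMSEQ_inverse_real_of_nat by (intro filterlim_atI) auto
      ultimately have "(\<lambda>n. (\<phi> (x + inverse (real (Suc n)) *\<^sub>R b) - \<phi> x) / inverse (real (Suc n)))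
          \<longlonglongrightarrow> pd b \<phi> x"
        by (rule filterlim_compose)
      then show "(\<lambda>n. q n x) \<longlonglongrightarrow> pd b \<phi> x"
        by (simp add: q_def divide_inverse add.commute del: of_nat_Suc)
    qed
    show "AE x in lborel. norm (q n x) \<le> indicat_real (cball 0 (R + 1)) x *\<^sub>R C" for n
    proof (rule AE_I2)
      fix x :: 'a
      define h where "h = inverse (real (Suc n))"
      have h: "0 < h" "h \<le> 1" "real (Suc n) = 1 / h" by (auto simp: h_def field_simps)
      obtain z where "\<phi> (x + h *\<^sub>R b) - \<phi> (x + 0 *\<^sub>R b) = (h - 0) * pd b \<phi> (x + z *\<^sub>R b)"
        using MVT2[OF h(1) line] by blast
      then have *: "q n x = pd b \<phi> (x + z *\<^sub>R b)"
        using h by (simp add: q_def h_def[symmetric] add.commute)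
      show "norm (q n x) \<le> indicat_real (cball 0 (R + 1)) x *\<^sub>R C"
      proof (cases "norm x \<le> R + 1")
        case True
        then show ?thesis using C * by simp
      next
        case False
        have "norm (h *\<^sub>R b + x) \<ge> norm x - norm (h *\<^sub>R b)"
          by (metis add.commute norm_diff_ineq)
        then have "norm (h *\<^sub>R b + x) > R" using False h assms(2) by simp
        moreover have "norm x > R" using False by simp
        ultimately have "\<phi> (h *\<^sub>R b + x) = 0" "\<phi> x = 0" using R K(4) not_le by metis+
        then show ?thesis using False by (simp add: q_def h_def[symmetric] del: of_nat_Suc)
      qed
    qed
  qed
  then show ?thesis by (simp add: q0 LIMSEQ_const_iff)
qed

text \<open>
  Integration by parts: \<open>q \<phi>\<close> is again a test function, so the integral of its derivative vanishes.
\<close>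

lemma smooth_weak_pd:
  assumes "open S" "smooth q" "b \<in> Basis"
  shows "weak_pd S b q (pd b q)"
  unfolding weak_pd_def L2_inner_def
proof
  fix \<phi> assume \<phi>: "\<phi> \<in> test_functions S"
  have s: "smooth \<phi>" using \<phi> test_functionsE by blast
  have t: "(\<lambda>x. q x * pd b \<phi> x) \<in> test_functions S" "(\<lambda>x. pd b q x * \<phi> x) \<in> test_functions S"
    by (intro test_functions_mult assms smooth_pd \<phi> test_functions_pd)+
  have "pd b (\<lambda>x. q x * \<phi> x) = (\<lambda>x. q x * pd b \<phi> x + pd b q x * \<phi> x)"
    using s assms by (auto simp: pd_mult smooth_differentiable)
  then have "(\<integral>x. q x * pd b \<phi> x + pd b q x * \<phi> x \<partial>lborel) = 0"
    using integral_pd_test_function[OF test_functions_mult[OF assms(2) \<phi>] assms(3)] by simp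
  then show "(\<integral>x. q x * pd b \<phi> x \<partial>lebesgue_on S) = - (\<integral>x. pd b q x * \<phi> x \<partial>lebesgue_on S)"
    using t assms(1) by (simp add: integral_test_function test_functions_integrable)
qed

section \<open>The fundamental lemma of the calculus of variations\<close>

text \<open>
  The product of \<open>exp(-1/(n t))\<close> over the distances \<open>t\<close> of the coordinates to the faces of the box
  is smooth, bounded by 1 and zero outside the box, and each factor tends to 1 where \<open>t > 0\<close>.
\<close>

lemma test_functions_tendsto_indicator_box:
  fixes a c :: "'a::euclidean_space"
  assumes "cbox a c \<subseteq> S"
  obtains \<phi> where "\<And>n. \<phi> n \<in> test_functions S" "\<And>n x. \<bar>\<phi> n x\<bar> \<le> 1"
    "\<And>x. (\<lambda>n. \<phi> n x) \<longlonglongrightarrow> indicator (box a c) x"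
proof -
  let ?e = "flat_exp 1"
  define \<phi> where "\<phi> n x = (\<Prod>b\<in>Basis.
      ?e (real (Suc n) * (x \<bullet> b - a \<bullet> b)) * ?e (real (Suc n) * (c \<bullet> b - x \<bullet> b)))" for n :: nat and x
  have e01: "0 \<le> ?e t" "?e t \<le> 1" for t by (auto simp: flat_exp_def)
  have e_lim: "(\<lambda>n. ?e (real (Suc n) * t)) \<longlonglongrightarrow> of_bool (0 < t)" for t
  proof (cases "0 < t")
    case True
    have "(\<lambda>n. exp (- (1 / t) * inverse (real (Suc n)))) \<longlonglongrightarrow> exp (- (1/t) * 0)"
      by (intro tendsto_intros LIMSEQ_inverse_real_of_nat)
    moreover have "(\<lambda>n. exp (- (1 / t) * inverse (real (Suc n)))) = (\<lambda>n. ?e (real (Suc n) * t))"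
      using True by (auto simp: flat_exp_def field_simps mult_le_0_iff simp del: of_nat_Suc)
    ultimately show ?thesis using True by simp
  next
    case False
    then have "?e (real (Suc n) * t) = 0" for n
      by (auto simp: flat_exp_def mult_le_0_iff simp del: of_nat_Suc)
    then show ?thesis using False by simp
  qed
  have "\<phi> n \<in> test_functions S" for n
  proof (rule test_functionsI[OF _ compact_cbox assms])
    have "smooth (\<lambda>x. ?e (real (Suc n) * (x \<bullet> b - a \<bullet> b)))" for b
    proof -
      have "(\<lambda>x. ?e (real (Suc n) * (x \<bullet> b - a \<bullet> b))) =
          (\<lambda>x. ?e (- real (Suc n) * (a \<bullet> b) + (real (Suc n) *\<^sub>R b) \<bullet> x))"
        by (simp add: algebra_simps inner_commute)
      then show ?thesis by (simp only: smooth_flat_exp_affine)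
    qed
    moreover have "smooth (\<lambda>x. ?e (real (Suc n) * (c \<bullet> b - x \<bullet> b)))" for b
    proof -
      have "(\<lambda>x. ?e (real (Suc n) * (c \<bullet> b - x \<bullet> b))) =
          (\<lambda>x. ?e (real (Suc n) * (c \<bullet> b) + (- real (Suc n) *\<^sub>R b) \<bullet> x))"
        by (simp add: algebra_simps inner_commute)
      then show ?thesis by (simp only: smooth_flat_exp_affine)
    qed
    ultimately show "smooth (\<phi> n)" unfolding \<phi>_def by (intro smooth_prod smooth_mult) auto
    show "\<phi> n x = 0" if x: "x \<notin> cbox a c" for x
    proof -
      obtain b where b: "b \<in> Basis" "\<not> (a \<bullet> b \<le> x \<bullet> b \<and> x \<bullet> b \<le> c \<bullet> b)"
        using x unfolding mem_box by blast
      then have "x \<bullet> b - a \<bullet> b \<le> 0 \<or> c \<bullet> b - x \<bullet> b \<le> 0" by linarith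
      then have "?e (real (Suc n) * (x \<bullet> b - a \<bullet> b)) * ?e (real (Suc n) * (c \<bullet> b - x \<bullet> b)) = 0"
        by (auto simp: flat_exp_def mult_le_0_iff simp del: of_nat_Suc)
      then show ?thesis unfolding \<phi>_def using b(1) by (auto simp: prod_zero_iff simp del: of_nat_Suc)
    qed
  qed
  moreover have "\<bar>\<phi> n x\<bar> \<le> 1" for n x
    unfolding \<phi>_def abs_prod using e01
    by (intro prod_le_1) (auto simp: abs_mult mult_le_one)
  moreover have "(\<lambda>n. \<phi> n x) \<longlonglongrightarrow> indicator (box a c) x" for x
  proof -
    have "(\<lambda>n. \<phi> n x) \<longlonglongrightarrow>
        (\<Prod>b\<in>Basis. of_bool (0 < x \<bullet> b - a \<bullet> b) * of_bool (0 < c \<bullet> b - x \<bullet> b))"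
      unfolding \<phi>_def by (intro tendsto_prod tendsto_mult e_lim)
    moreover have "(\<Prod>b\<in>Basis. of_bool (0 < x \<bullet> b - a \<bullet> b) * of_bool (0 < c \<bullet> b - x \<bullet> b))
        = indicat_real (box a c) x"
      by (cases "x \<in> box a c") (auto simp: mem_box indicator_def not_less prod_zero_iff intro!: prod.neutral)
    ultimately show ?thesis by simp
  qed
  ultimately show ?thesis using that by blast
qed

text \<open>
  Boxes are stable under intersection and generate the Borel sets.  Sets over which the integral
  vanishes form a Dynkin system, so the integral is zero over every Borel set.
\<close>

lemma AE_lborel_0_if_box_integrals_0:
  fixes G :: "'a::euclidean_space \<Rightarrow> real"
  assumes int: "integrable lborel G"
    and box: "\<And>a b. (\<integral>x\<in>box a b. G x \<partial>lborel) = 0"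
  shows "AE x in lborel. G x = 0"
proof -
  have si: "set_integrable lborel A G" if "A \<in> sets borel" for A
    using int that unfolding set_integrable_def by (intro integrable_mult_indicator) auto
  have bU: "(\<integral>x\<in>UNIV. G x \<partial>lborel) = 0"
  proof -
    have "(\<lambda>n. \<integral>x\<in>box (- real n *\<^sub>R One) (real n *\<^sub>R One). G x \<partial>lborel)
        \<longlonglongrightarrow> (\<integral>x\<in>(\<Union>n. box (- real n *\<^sub>R One) (real n *\<^sub>R One)). G x \<partial>lborel)"
      by (rule set_integral_cont_up) (force simp: incseq_def mem_box UN_box_eq_UNIV si)+
    then show ?thesis by (simp add: box UN_box_eq_UNIV LIMSEQ_const_iff)
  qed
  have "(\<integral>x\<in>A. G x \<partial>lborel) = 0" if "A \<in> sets borel" for A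
  proof -
    let ?E = "range (\<lambda>(a, b). box a b :: 'a set)"
    have "Int_stable ?E"
      unfolding Int_stable_def by (auto simp: box_Int_box)
    moreover have "?E \<subseteq> Pow UNIV" by simp
    moreover have "A \<in> sigma_sets UNIV ?E"
      using that by (subst (asm) borel_eq_box) simp
    ultimately show ?thesis
    proof (induction rule: sigma_sets_induct_disjoint)
      case (basic A) then show ?case by (auto simp: box)
    next
      case empty then show ?case by (simp add: set_lebesgue_integral_def)
    next
      case (compl A)
      then have m: "A \<in> sets borel" by (subst borel_eq_box) simp
      have "(\<integral>x\<in>A \<union> (UNIV - A). G x \<partial>lborel) = (\<integral>x\<in>A. G x \<partial>lborel) + (\<integral>x\<in>UNIV - A. G x \<partial>lborel)"
        using m by (intro set_integral_Un si) auto
      then show ?case using compl bU by simp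
    next
      case (union A)
      then have m: "A i \<in> sets borel" for i by (subst borel_eq_box) auto
      have "(\<integral>x\<in>(\<Union>i. A i). G x \<partial>lborel) = (\<Sum>i. (\<integral>x\<in>A i. G x \<partial>lborel))"
        using union(1) m
        by (intro lebesgue_integral_countable_add si) (auto simp: disjoint_family_on_def)
      then show ?case using union by simp
    qed
  qed
  then show ?thesis
    by (intro density_unique_real int) (auto simp: set_lebesgue_integral_def)
qed

text \<open>
  Dominated convergence along test functions that approach the indicator of a box shows that \<open>g\<close>
  integrates to zero over every box whose closure lies in \<open>S\<close>.  This makes \<open>g\<close> vanish almost
  everywhere in each such box, and countably many of them exhaust \<open>S\<close> up to a null set.
\<close>

lemma fundamental_lemma_of_variations:
  fixes g :: "'a::euclidean_space \<Rightarrow> real"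
  assumes S: "open S" and int: "integrable (lebesgue_on S) g"
    and zero: "\<And>\<phi>. \<phi> \<in> test_functions S \<Longrightarrow> (\<integral>x. g x * \<phi> x \<partial>lebesgue_on S) = 0"
  shows "AE x in lebesgue_on S. g x = 0"
proof -
  have Sm: "S \<in> sets lebesgue" using S by simp
  have box_zero: "(\<integral>x. g x * indicator (box a c) x \<partial>lebesgue_on S) = 0" if sub: "cbox a c \<subseteq> S" for a c
  proof -
    obtain \<phi> where \<phi>: "\<And>n. \<phi> n \<in> test_functions S" "\<And>n x. \<bar>\<phi> n x\<bar> \<le> 1"
      "\<And>x. (\<lambda>n. \<phi> n x) \<longlonglongrightarrow> indicator (box a c) x"
      using test_functions_tendsto_indicator_box[OF sub] by blast
    have m: "\<phi> n \<in> borel_measurable (lebesgue_on S)" for n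
      using \<phi>(1)[of n] by (auto elim!: test_functionsE
          intro!: continuous_imp_measurable_on_sets_lebesgue smooth_continuous Sm)
    have "(\<lambda>n. \<integral>x. g x * \<phi> n x \<partial>lebesgue_on S) \<longlonglongrightarrow> (\<integral>x. g x * indicator (box a c) x \<partial>lebesgue_on S)"
    proof (rule integral_dominated_convergence[where w = "\<lambda>x. norm (g x)"])
      show "(\<lambda>x. g x * indicat_real (box a c) x) \<in> borel_measurable (lebesgue_on S)"
      proof -
        have "S \<inter> box a c \<in> sets (lebesgue_on S)"
          using Sm by (auto simp: sets_restrict_space_iff)
        moreover have "S \<inter> box a c = {x \<in> space (lebesgue_on S). x \<in> box a c}" by auto
        ultimately show ?thesis
          using int by (intro borel_measurable_times borel_measurable_indicator') auto
      qed
      show "AE x in lebesgue_on S. norm (g x * \<phi> n x) \<le> norm (g x)" for n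
        using \<phi>(2) by (auto simp: abs_mult mult_left_le)
    qed (use int m \<phi>(3) in \<open>auto intro!: tendsto_intros\<close>)
    then show ?thesis by (simp add: zero[OF \<phi>(1)] LIMSEQ_const_iff)
  qed
  have AE_box: "AE x in lebesgue. x \<in> box a c \<longrightarrow> g x = 0" if sub: "cbox a c \<subseteq> S" for a c
  proof -
    \<comment> \<open>Extension by zero and passage to a Borel representative \<open>h'\<close>, as boxes generate Borel sets only.\<close>
    define h where "h x = (if x \<in> S then g x * indicator (box a c) x else 0)" for x
    have "S \<inter> box a c \<in> sets (lebesgue_on S)"
      using Sm by (auto simp: sets_restrict_space_iff)
    from Lebesgue_Measure.integrable_restrict_UNIV[OF Sm, THEN iffD2,
        OF integrable_real_mult_indicator[OF this int]]
    have "integrable lebesgue (\<lambda>x. if x \<in> S then g x * indicator (S \<inter> box a c) x else 0)" .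
    moreover have "(\<lambda>x. if x \<in> S then g x * indicator (S \<inter> box a c) x else 0) = h"
      by (rule ext) (simp add: h_def indicator_def)
    ultimately have hi: "integrable lebesgue h" by simp
    then obtain h' where h': "h' \<in> borel_measurable lborel" "AE x in lborel. h x = h' x"
      using completion_ex_borel_measurable_real[of h lborel] by auto
    then have AEh: "AE x in lebesgue. h x = h' x" by (simp add: AE_completion)
    have h'i: "integrable lborel h'"
    proof -
      have "integrable lebesgue h'"
        using hi AEh h'(1) by (subst integrable_cong_AE[where g = h]) (auto intro: measurable_completion)
      then show ?thesis using integrable_completion[of h' lborel] h'(1) by simp
    qed
    have "AE x in lborel. h' x = 0"
    proof (rule AE_lborel_0_if_box_integrals_0[OF h'i])
      fix p q :: 'a
      \<comment> \<open>The intersection with the fixed box is a box with closure in \<open>S\<close> again, unless it is empty.\<close>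
      obtain r s where rs: "box a c \<inter> box p q = box r s" by (auto simp: box_Int_box)
      have sub': "box r s \<subseteq> S" "box r s = {} \<or> cbox r s \<subseteq> S"
      proof -
        show "box r s \<subseteq> S" using rs sub box_subset_cbox by blast
        have "cbox r s \<subseteq> cbox a c" if "box r s \<noteq> {}"
        proof -
          have "closure (box r s) \<subseteq> closure (box a c)" using rs by (intro closure_mono) auto
          moreover have "box a c \<noteq> {}" using that rs by blast
          ultimately show ?thesis using that by (simp add: closure_box)
        qed
        then show "box r s = {} \<or> cbox r s \<subseteq> S" using sub by blast
      qed
      have "(\<integral>x\<in>box p q. h' x \<partial>lborel) = (\<integral>x. indicator (box p q) x * h' x \<partial>lebesgue)"
        unfolding set_lebesgue_integral_def using h'(1)
        by (subst integral_completion) auto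
      also have "\<dots> = (\<integral>x. indicator (box p q) x * h x \<partial>lebesgue)"
      proof (rule integral_cong_AE)
        show "(\<lambda>x. indicator (box p q) x * h' x) \<in> borel_measurable lebesgue"
          using h'(1) by (auto intro: measurable_completion)
        show "(\<lambda>x. indicator (box p q) x * h x) \<in> borel_measurable lebesgue"
          using hi by (intro borel_measurable_times borel_measurable_indicator) auto
      qed (use AEh in \<open>auto elim!: eventually_mono\<close>)
      also have "\<dots> = (\<integral>x. (if x \<in> S then g x * indicator (box r s) x else 0) \<partial>lebesgue)"
        by (intro Bochner_Integration.integral_cong) (auto simp: h_def rs[symmetric] indicator_def)
      also have "\<dots> = (\<integral>x. g x * indicator (box r s) x \<partial>lebesgue_on S)"
        by (rule Lebesgue_Measure.integral_restrict_UNIV[OF Sm])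
      also have "\<dots> = 0" using sub'(2) box_zero by auto
      finally show "(\<integral>x\<in>box p q. h' x \<partial>lborel) = 0" .
    qed
    then have "AE x in lebesgue. h' x = 0" by (simp add: AE_completion)
    then show ?thesis using AEh
    proof eventually_elim
      case (elim x)
      then show ?case using sub box_subset_cbox[of a c] by (auto simp: h_def)
    qed
  qed
  obtain D where D: "countable D" "D \<subseteq> Pow S" "\<And>X. X \<in> D \<Longrightarrow> \<exists>a b. X = cbox a b" "\<Union>D = S"
    using open_countable_Union_open_cbox[OF S] by metis
  have AE_D: "AE x in lebesgue. x \<in> X \<longrightarrow> g x = 0" if X: "X \<in> D" for X
  proof -
    obtain a c where ac: "X = cbox a c" "cbox a c \<subseteq> S" using D(2,3) X by blast
    have "AE x in lebesgue. x \<notin> cbox a c - box a c"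
      using negligible_frontier_interval[of a c] by (intro AE_not_in) (simp add: negligible_iff_null_sets)
    with AE_box[OF ac(2)] show ?thesis by eventually_elim (auto simp: ac(1))
  qed
  have "AE x in lebesgue. \<forall>X\<in>D. x \<in> X \<longrightarrow> g x = 0"
    unfolding AE_ball_countable[OF D(1)] using AE_D by blast
  then have "AE x in lebesgue. x \<in> S \<longrightarrow> g x = 0"
    using D(4) by (auto elim!: eventually_mono)
  then show ?thesis using AE_restrict_space_iff[of S lebesgue] Sm by auto
qed

section \<open>Weak gradients on bounded open sets\<close>

lemma bounded_open_lmeasurable: "open S \<Longrightarrow> bounded S \<Longrightarrow> S \<in> lmeasurable"
  by (simp add: lmeasurable_open)

lemma L2_prod_integrable:
  assumes "u \<in> L2 S" "v \<in> L2 S"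
  shows "integrable (lebesgue_on S) (\<lambda>x. u x * v x)"
proof (rule Bochner_Integration.integrable_bound)
  show "integrable (lebesgue_on S) (\<lambda>x. (u x)\<^sup>2 + (v x)\<^sup>2)"
    using assms by (auto simp: L2_def)
  show "(\<lambda>x. u x * v x) \<in> borel_measurable (lebesgue_on S)"
    using assms by (auto simp: L2_def)
  have "\<bar>u x * v x\<bar> \<le> (u x)\<^sup>2 + (v x)\<^sup>2" for x
    using sum_squares_bound[of "\<bar>u x\<bar>" "\<bar>v x\<bar>"] mult_nonneg_nonneg[of "\<bar>u x\<bar>" "\<bar>v x\<bar>"]
    unfolding abs_mult power2_abs by linarith
  then show "AE x in lebesgue_on S. norm (u x * v x) \<le> norm ((u x)\<^sup>2 + (v x)\<^sup>2)" by simp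
qed

lemma L2_lincomb:
  assumes "u \<in> L2 S" "v \<in> L2 S"
  shows "(\<lambda>x. a * u x + b * v x) \<in> L2 S"
proof -
  have "(\<lambda>x. (a * u x + b * v x)\<^sup>2)
      = (\<lambda>x. a\<^sup>2 * (u x * u x) + 2 * a * b * (u x * v x) + b\<^sup>2 * (v x * v x))"
    by (auto simp: power2_eq_square algebra_simps)
  moreover have "integrable (lebesgue_on S) \<dots>"
    using L2_prod_integrable assms by (intro Bochner_Integration.integrable_add integrable_mult_right) auto
  ultimately show ?thesis using assms by (auto simp: L2_def)
qed

lemma L2_inner_lincomb:
  assumes "u \<in> L2 S" "v \<in> L2 S" "w \<in> L2 S"
  shows "L2_inner S (\<lambda>x. a * u x + b * v x) w = a * L2_inner S u w + b * L2_inner S v w"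
  unfolding L2_inner_def using assms
  by (simp add: distrib_right mult.assoc L2_prod_integrable)

lemma L2_inner_sym: "L2_inner S u v = L2_inner S v u"
  by (simp add: L2_inner_def mult.commute)

text \<open>
  Covers test functions, affine functions and loads in \<open>Linf\<close> alike, since all domains are bounded.
\<close>

lemma L2_bounded:
  assumes S: "S \<in> lmeasurable" and m: "u \<in> borel_measurable (lebesgue_on S)"
    and C: "AE x in lebesgue_on S. \<bar>u x\<bar> \<le> C"
  shows "u \<in> L2 S"
proof -
  interpret finite_measure "lebesgue_on S" by (rule finite_measure_lebesgue_on[OF S])
  have "AE x in lebesgue_on S. norm ((u x)\<^sup>2) \<le> C\<^sup>2"
    using C by eventually_elim (simp add: abs_le_square_iff[symmetric])
  then have "integrable (lebesgue_on S) (\<lambda>x. (u x)\<^sup>2)"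
    using m by (intro integrable_const_bound) auto
  then show ?thesis using m by (simp add: L2_def)
qed

lemma L2_continuous_bounded:
  fixes u :: "'a::euclidean_space \<Rightarrow> real"
  assumes "open S" "bounded S" "continuous_on S u" "\<And>x. x \<in> S \<Longrightarrow> \<bar>u x\<bar> \<le> C"
  shows "u \<in> L2 S"
  using assms by (intro L2_bounded[of S u C] bounded_open_lmeasurable
      continuous_imp_measurable_on_sets_lebesgue) (auto intro!: AE_I2)

lemma L2_affine:
  assumes "open S" "bounded S"
  shows "(\<lambda>x. c + w \<bullet> x) \<in> L2 S"
proof -
  obtain R where R: "\<And>x. x \<in> S \<Longrightarrow> norm x \<le> R" using assms(2) unfolding bounded_iff by blast
  have "\<bar>c + w \<bullet> x\<bar> \<le> \<bar>c\<bar> + norm w * R" if "x \<in> S" for x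
  proof -
    have "\<bar>w \<bullet> x\<bar> \<le> norm w * R"
      using Cauchy_Schwarz_ineq2[of w x] mult_left_mono[OF R[OF that], of "norm w"] by simp
    then show ?thesis by linarith
  qed
  then show ?thesis using assms by (intro L2_continuous_bounded continuous_intros)
qed

lemma L2_const: "open S \<Longrightarrow> bounded S \<Longrightarrow> (\<lambda>x. c) \<in> L2 S"
  using L2_affine[of S c 0] by simp

lemma L2_integrable: "open S \<Longrightarrow> bounded S \<Longrightarrow> u \<in> L2 S \<Longrightarrow> integrable (lebesgue_on S) u"
  using L2_prod_integrable[OF _ L2_const[of S 1]] by simp

lemma L2_test_function:
  assumes "open S" "bounded S" "\<phi> \<in> test_functions S"
  shows "\<phi> \<in> L2 S"
proof -
  obtain C where "\<And>x. \<bar>\<phi> x\<bar> \<le> C" using test_functions_bounded[OF assms(3)] by blast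
  moreover have "smooth \<phi>" using assms(3) test_functionsE by blast
  ultimately show ?thesis using assms by (intro L2_continuous_bounded smooth_continuous)
qed

lemma weak_grad_integrable:
  assumes "is_weak_grad S u g" "is_weak_grad S v h"
  shows "integrable (lebesgue_on S) (\<lambda>x. g x \<bullet> h x)"
proof -
  have "integrable (lebesgue_on S) (\<lambda>x. \<Sum>b\<in>Basis. (g x \<bullet> b) * (h x \<bullet> b))"
    using assms by (intro Bochner_Integration.integrable_sum L2_prod_integrable)
      (auto simp: is_weak_grad_def)
  then show ?thesis by (subst euclidean_inner)
qed

lemma is_weak_grad_lincomb:
  assumes S: "open S" "bounded S" and "u \<in> L2 S" "v \<in> L2 S" "is_weak_grad S u g" "is_weak_grad S v h"
  shows "is_weak_grad S (\<lambda>x. a * u x + b * v x) (\<lambda>x. a *\<^sub>R g x + b *\<^sub>R h x)"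
  unfolding is_weak_grad_def inner_add_left inner_scaleR_left
proof (intro ballI conjI)
  fix e :: 'a assume e: "e \<in> Basis"
  have L: "(\<lambda>x. g x \<bullet> e) \<in> L2 S" "(\<lambda>x. h x \<bullet> e) \<in> L2 S"
    and w: "weak_pd S e u (\<lambda>x. g x \<bullet> e)" "weak_pd S e v (\<lambda>x. h x \<bullet> e)"
    using e assms by (auto simp: is_weak_grad_def)
  then show "(\<lambda>x. a * (g x \<bullet> e) + b * (h x \<bullet> e)) \<in> L2 S" by (intro L2_lincomb)
  show "weak_pd S e (\<lambda>x. a * u x + b * v x) (\<lambda>x. a * (g x \<bullet> e) + b * (h x \<bullet> e))"
    unfolding weak_pd_def
  proof
    fix \<phi> assume \<phi>: "\<phi> \<in> test_functions S"
    then have "\<phi> \<in> L2 S" "pd e \<phi> \<in> L2 S"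
      using S e by (auto intro: L2_test_function test_functions_pd)
    moreover have "L2_inner S u (pd e \<phi>) = - L2_inner S (\<lambda>x. g x \<bullet> e) \<phi>"
      "L2_inner S v (pd e \<phi>) = - L2_inner S (\<lambda>x. h x \<bullet> e) \<phi>"
      using w \<phi> by (auto simp: weak_pd_def)
    ultimately show "L2_inner S (\<lambda>x. a * u x + b * v x) (pd e \<phi>)
        = - L2_inner S (\<lambda>x. a * (g x \<bullet> e) + b * (h x \<bullet> e)) \<phi>"
      using assms L by (simp add: L2_inner_lincomb)
  qed
qed

text \<open>
  The components of the difference are orthogonal to all test functions.  They are integrable
  because the domain is bounded, so the fundamental lemma applies.
\<close>

lemma is_weak_grad_unique:
  assumes S: "open S" "bounded S" and g: "is_weak_grad S u g" and h: "is_weak_grad S u h"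
  shows "AE x in lebesgue_on S. g x = h x"
proof -
  have "AE x in lebesgue_on S. 1 * (g x \<bullet> b) + (- 1) * (h x \<bullet> b) = 0" if b: "b \<in> Basis" for b
  proof -
    have L: "(\<lambda>x. g x \<bullet> b) \<in> L2 S" "(\<lambda>x. h x \<bullet> b) \<in> L2 S"
      and w: "weak_pd S b u (\<lambda>x. g x \<bullet> b)" "weak_pd S b u (\<lambda>x. h x \<bullet> b)"
      using b g h by (auto simp: is_weak_grad_def)
    show ?thesis
    proof (rule fundamental_lemma_of_variations[OF S(1)])
      show "integrable (lebesgue_on S) (\<lambda>x. 1 * (g x \<bullet> b) + (- 1) * (h x \<bullet> b))"
        by (intro L2_integrable S L2_lincomb L)
      fix \<phi> assume \<phi>: "\<phi> \<in> test_functions S"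
      then have "L2_inner S (\<lambda>x. 1 * (g x \<bullet> b) + (- 1) * (h x \<bullet> b)) \<phi>
          = 1 * L2_inner S (\<lambda>x. g x \<bullet> b) \<phi> + (-1) * L2_inner S (\<lambda>x. h x \<bullet> b) \<phi>"
        using S by (intro L2_inner_lincomb L L2_test_function)
      then show "(\<integral>x. (1 * (g x \<bullet> b) + (- 1) * (h x \<bullet> b)) * \<phi> x \<partial>lebesgue_on S) = 0"
        using w \<phi> unfolding weak_pd_def by (simp add: L2_inner_def)
    qed
  qed
  then have "AE x in lebesgue_on S. \<forall>b\<in>Basis. 1 * (g x \<bullet> b) + (- 1) * (h x \<bullet> b) = 0"
    by (subst AE_finite_all) auto
  then show ?thesis by eventually_elim (auto intro: euclidean_eqI)
qed

lemma weak_grad_someI: "is_weak_grad S u g \<Longrightarrow> is_weak_grad S u (weak_grad S u)"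
  unfolding weak_grad_def by (rule someI[where P = "is_weak_grad S u"])

lemma is_weak_grad_weak_grad: "u \<in> H1 S \<Longrightarrow> is_weak_grad S u (weak_grad S u)"
  unfolding H1_def using weak_grad_someI by blast

lemma weak_grad_eq:
  assumes "open S" "bounded S" "is_weak_grad S u g"
  shows "AE x in lebesgue_on S. weak_grad S u x = g x"
  using is_weak_grad_unique[OF assms(1,2) weak_grad_someI[OF assms(3)] assms(3)] .

lemma H1_L2: "u \<in> H1 S \<Longrightarrow> u \<in> L2 S"
  by (simp add: H1_def)

lemma H1_lincomb:
  assumes "open S" "bounded S" "u \<in> H1 S" "v \<in> H1 S"
  shows "(\<lambda>x. a * u x + b * v x) \<in> H1 S"
proof -
  have "is_weak_grad S (\<lambda>x. a * u x + b * v x) (\<lambda>x. a *\<^sub>R weak_grad S u x + b *\<^sub>R weak_grad S v x)"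
    using assms by (intro is_weak_grad_lincomb is_weak_grad_weak_grad H1_L2)
  moreover have "(\<lambda>x. a * u x + b * v x) \<in> L2 S" using assms by (intro L2_lincomb H1_L2)
  ultimately show ?thesis unfolding H1_def by blast
qed

lemma weak_grad_lincomb:
  assumes "open S" "bounded S" "u \<in> H1 S" "v \<in> H1 S"
  shows "AE x in lebesgue_on S. weak_grad S (\<lambda>x. a * u x + b * v x) x
      = a *\<^sub>R weak_grad S u x + b *\<^sub>R weak_grad S v x"
  using assms by (intro weak_grad_eq is_weak_grad_lincomb is_weak_grad_weak_grad H1_L2)

lemma weak_grad_measurable:
  assumes "is_weak_grad S u g"
  shows "g \<in> borel_measurable (lebesgue_on S)"
proof -
  have "(\<lambda>x. \<Sum>b\<in>Basis. (g x \<bullet> b) *\<^sub>R b) \<in> borel_measurable (lebesgue_on S)"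
    using assms by (intro borel_measurable_sum borel_measurable_scaleR)
      (auto simp: is_weak_grad_def L2_def)
  then show ?thesis by (simp add: euclidean_representation)
qed

lemma weak_grad_vector_integrable:
  assumes "open S" "bounded S" "is_weak_grad S u g"
  shows "integrable (lebesgue_on S) g"
proof -
  have "integrable (lebesgue_on S) (\<lambda>x. \<Sum>b\<in>Basis. (g x \<bullet> b) *\<^sub>R b)"
    using assms by (intro Bochner_Integration.integrable_sum integrable_scaleR_left L2_integrable)
      (auto simp: is_weak_grad_def)
  then show ?thesis by (simp add: euclidean_representation)
qed

text \<open>
  Frees later computations from the chosen representative: any weak gradient may be inserted.
\<close>

lemma grad_inner_eq:
  assumes S: "open S" "bounded S" and g: "is_weak_grad S u g" and h: "is_weak_grad S v h"
  shows "grad_inner S u v = (\<integral>x. g x \<bullet> h x \<partial>lebesgue_on S)"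
  unfolding grad_inner_def
proof (rule integral_cong_AE)
  have "is_weak_grad S u (weak_grad S u)" "is_weak_grad S v (weak_grad S v)"
    using g h by (auto intro: weak_grad_someI)
  then show "(\<lambda>x. weak_grad S u x \<bullet> weak_grad S v x) \<in> borel_measurable (lebesgue_on S)"
    by (rule borel_measurable_integrable[OF weak_grad_integrable])
  show "(\<lambda>x. g x \<bullet> h x) \<in> borel_measurable (lebesgue_on S)"
    using weak_grad_integrable[OF g h] by (rule borel_measurable_integrable)
  show "AE x in lebesgue_on S. weak_grad S u x \<bullet> weak_grad S v x = g x \<bullet> h x"
    using weak_grad_eq[OF S g] weak_grad_eq[OF S h] by eventually_elim simp
qed

lemma grad_inner_sym: "grad_inner S u v = grad_inner S v u"
  by (simp add: grad_inner_def inner_commute)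

lemma grad_inner_nonneg: "0 \<le> grad_inner S u u"
  by (simp add: grad_inner_def)

lemma L2_inner_nonneg: "0 \<le> L2_inner S u u"
  by (simp add: L2_inner_def)

lemma grad_inner_lincomb:
  assumes S: "open S" "bounded S" and u: "u \<in> H1 S" "v \<in> H1 S" "w \<in> H1 S"
  shows "grad_inner S (\<lambda>x. a * u x + b * v x) w = a * grad_inner S u w + b * grad_inner S v w"
proof -
  note I = weak_grad_integrable[OF is_weak_grad_weak_grad is_weak_grad_weak_grad]
  have "grad_inner S (\<lambda>x. a * u x + b * v x) w
     = (\<integral>x. (a *\<^sub>R weak_grad S u x + b *\<^sub>R weak_grad S v x) \<bullet> weak_grad S w x \<partial>lebesgue_on S)"
    using assms by (intro grad_inner_eq is_weak_grad_lincomb is_weak_grad_weak_grad H1_L2)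
  then show ?thesis
    using I[OF u(1) u(3)] I[OF u(2) u(3)] by (simp add: inner_add_left grad_inner_def)
qed

lemma smooth_H1:
  assumes "open S" "bounded S" "smooth q" "q \<in> L2 S" "\<And>b. b \<in> Basis \<Longrightarrow> pd b q \<in> L2 S"
  shows "is_weak_grad S q (\<lambda>x. \<Sum>b\<in>Basis. pd b q x *\<^sub>R b)" "q \<in> H1 S"
proof -
  show "is_weak_grad S q (\<lambda>x. \<Sum>b\<in>Basis. pd b q x *\<^sub>R b)"
    unfolding is_weak_grad_def using assms by (simp add: smooth_weak_pd inner_sum_left inner_Basis if_distrib[of "(*) _"] cong: if_cong)
  then show "q \<in> H1 S" using assms(4) by (auto simp: H1_def)
qed

lemma test_function_H1:
  assumes "open S" "bounded S" "\<phi> \<in> test_functions S"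
  shows "\<phi> \<in> H1 S"
  using assms test_functionsE[OF assms(3)]
  by (intro smooth_H1) (auto intro: L2_test_function test_functions_pd)

lemma affine_weak_grad:
  assumes "open S" "bounded S"
  shows "is_weak_grad S (\<lambda>x. c + w \<bullet> x) (\<lambda>x. w)" "(\<lambda>x. c + w \<bullet> x) \<in> H1 S"
  using smooth_H1[OF assms smooth_affine[where c = c and w = w] L2_affine[OF assms]]
  by (auto simp: pd_affine L2_const assms euclidean_representation)

text \<open>
  One integration by parts leaves the constant slope times the integral of a first derivative of
  a test function, which is zero.
\<close>

lemma weakly_harmonic_affine:
  fixes w :: "'a::euclidean_space"
  assumes "open S" "bounded S"
  shows "weakly_harmonic S (\<lambda>x. c + w \<bullet> x)"
  unfolding weakly_harmonic_def
proof
  fix \<phi> :: "'a \<Rightarrow> real" assume \<phi>: "\<phi> \<in> test_functions S"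
  let ?q = "\<lambda>x. c + w \<bullet> x"
  have t: "pd b \<phi> \<in> test_functions S" "pd b (pd b \<phi>) \<in> test_functions S" if "b \<in> Basis" for b
    using \<phi> that by (auto intro: test_functions_pd)
  have I: "L2_inner S ?q (pd b (pd b \<phi>)) = 0" if b: "b \<in> Basis" for b
  proof -
    have "L2_inner S ?q (pd b (pd b \<phi>)) = - L2_inner S (\<lambda>x. w \<bullet> b) (pd b \<phi>)"
      using smooth_weak_pd[OF assms(1) smooth_affine[where c = c and w = w] b] t[OF b]
      by (simp add: weak_pd_def pd_affine)
    also have "\<dots> = - ((w \<bullet> b) * (\<integral>x. pd b \<phi> x \<partial>lborel))"
      using t[OF b] assms by (simp add: L2_inner_def integral_test_function)
    finally show ?thesis using integral_pd_test_function[OF \<phi> b] by simp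
  qed
  have "L2_inner S ?q (\<lambda>x. \<Sum>b\<in>Basis. pd b (pd b \<phi>) x) = (\<Sum>b\<in>Basis. L2_inner S ?q (pd b (pd b \<phi>)))"
    unfolding L2_inner_def sum_distrib_left
    using t assms by (intro Bochner_Integration.integral_sum L2_prod_integrable L2_affine L2_test_function)
  then show "L2_inner S ?q (\<lambda>x. \<Sum>b\<in>Basis. pd b (pd b \<phi>) x) = 0" using I by simp
qed

lemma weakly_harmonic_lincomb:
  assumes "open S" "bounded S" "u \<in> L2 S" "v \<in> L2 S" "weakly_harmonic S u" "weakly_harmonic S v"
  shows "weakly_harmonic S (\<lambda>x. a * u x + b * v x)"
  unfolding weakly_harmonic_def
proof
  fix \<phi> :: "'a \<Rightarrow> real" assume \<phi>: "\<phi> \<in> test_functions S"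
  have "finite A \<Longrightarrow> A \<subseteq> Basis \<Longrightarrow> (\<lambda>x. \<Sum>b\<in>A. pd b (pd b \<phi>) x) \<in> L2 S" for A
  proof (induction A rule: finite_induct)
    case (insert c A)
    then have "(\<lambda>x. 1 * pd c (pd c \<phi>) x + 1 * (\<Sum>b\<in>A. pd b (pd b \<phi>) x)) \<in> L2 S"
      using L2_test_function[OF assms(1,2) test_functions_pd[OF test_functions_pd[OF \<phi>]], of c c]
      by (intro L2_lincomb) auto
    then show ?case using insert by simp
  qed (use assms in \<open>simp add: L2_const\<close>)
  then have "(\<lambda>x. \<Sum>b\<in>Basis. pd b (pd b \<phi>) x) \<in> L2 S" by simp
  then show "L2_inner S (\<lambda>x. a * u x + b * v x) (\<lambda>x. \<Sum>b\<in>Basis. pd b (pd b \<phi>) x) = 0"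
    using assms \<phi> by (simp add: L2_inner_lincomb weakly_harmonic_def)
qed

text \<open>
  A substitute for the triangle inequality that follows at once from the parallelogram identity;
  the constant 2 does no harm where only convergence to zero is concerned.
\<close>

lemma H1_norm_lincomb:
  assumes S: "open S" "bounded S" and u: "u \<in> H1 S" "v \<in> H1 S"
  shows "(H1_norm S (\<lambda>x. a * u x + b * v x))\<^sup>2
      \<le> 2 * a\<^sup>2 * (H1_norm S u)\<^sup>2 + 2 * b\<^sup>2 * (H1_norm S v)\<^sup>2"
proof -
  have sq: "(H1_norm S w)\<^sup>2 = L2_inner S w w + grad_inner S w w" for w :: "'a \<Rightarrow> real"
    by (simp add: H1_norm_def L2_inner_nonneg grad_inner_nonneg)
  \<comment> \<open>Adding the square of the norm of the difference cancels the mixed terms.\<close>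
  let ?p = "\<lambda>x. a * u x + b * v x" and ?m = "\<lambda>x. a * u x + (- b) * v x"
  note H = H1_lincomb[OF S u]
  have e: "L2_inner S (\<lambda>x. a * u x + c * v x) (\<lambda>x. a * u x + c * v x)
      = a\<^sup>2 * L2_inner S u u + 2 * a * c * L2_inner S u v + c\<^sup>2 * L2_inner S v v" for c
  proof -
    let ?w = "\<lambda>x. a * u x + c * v x"
    have "L2_inner S ?w ?w = a * L2_inner S u ?w + c * L2_inner S v ?w"
      by (rule L2_inner_lincomb[OF H1_L2[OF u(1)] H1_L2[OF u(2)] H1_L2[OF H]])
    also have "L2_inner S u ?w = a * L2_inner S u u + c * L2_inner S u v"
      using L2_inner_lincomb[OF H1_L2[OF u(1)] H1_L2[OF u(2)] H1_L2[OF u(1)]] by (simp only: L2_inner_sym[of S u ?w] L2_inner_sym[of S v u])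
    also have "L2_inner S v ?w = a * L2_inner S u v + c * L2_inner S v v"
      using L2_inner_lincomb[OF H1_L2[OF u(1)] H1_L2[OF u(2)] H1_L2[OF u(2)]] by (simp only: L2_inner_sym[of S v ?w])
    finally show ?thesis by (simp add: power2_eq_square algebra_simps)
  qed
  have g: "grad_inner S (\<lambda>x. a * u x + c * v x) (\<lambda>x. a * u x + c * v x)
      = a\<^sup>2 * grad_inner S u u + 2 * a * c * grad_inner S u v + c\<^sup>2 * grad_inner S v v" for c
  proof -
    let ?w = "\<lambda>x. a * u x + c * v x"
    have "grad_inner S ?w ?w = a * grad_inner S u ?w + c * grad_inner S v ?w"
      by (rule grad_inner_lincomb[OF S u(1) u(2) H])
    also have "grad_inner S u ?w = a * grad_inner S u u + c * grad_inner S u v"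
      using grad_inner_lincomb[OF S u(1) u(2) u(1)] by (simp only: grad_inner_sym[of S u ?w] grad_inner_sym[of S v u])
    also have "grad_inner S v ?w = a * grad_inner S u v + c * grad_inner S v v"
      using grad_inner_lincomb[OF S u(1) u(2) u(2)] by (simp only: grad_inner_sym[of S v ?w])
    finally show ?thesis by (simp add: power2_eq_square algebra_simps)
  qed
  have "(H1_norm S ?p)\<^sup>2 + (H1_norm S ?m)\<^sup>2 = 2 * a\<^sup>2 * (H1_norm S u)\<^sup>2 + 2 * b\<^sup>2 * (H1_norm S v)\<^sup>2"
    unfolding sq e g by (simp add: algebra_simps)
  then show ?thesis using zero_le_power2[of "H1_norm S ?m"] by linarith
qed

lemma H10_lincomb:
  assumes S: "open S" "bounded S" and u: "u \<in> H10 S" "v \<in> H10 S"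
  shows "(\<lambda>x. a * u x + b * v x) \<in> H10 S"
proof -
  obtain \<phi> \<psi> where \<phi>: "\<And>k. \<phi> k \<in> test_functions S" "(\<lambda>k. H1_norm S (\<lambda>x. u x - \<phi> k x)) \<longlonglongrightarrow> 0"
    and \<psi>: "\<And>k. \<psi> k \<in> test_functions S" "(\<lambda>k. H1_norm S (\<lambda>x. v x - \<psi> k x)) \<longlonglongrightarrow> 0"
    and H: "u \<in> H1 S" "v \<in> H1 S"
    using u unfolding H10_def by blast
  let ?d = "\<lambda>k x. a * u x + b * v x - (a * \<phi> k x + b * \<psi> k x)"
  have le: "(H1_norm S (?d k))\<^sup>2 \<le> 2 * a\<^sup>2 * (H1_norm S (\<lambda>x. u x - \<phi> k x))\<^sup>2 + 2 * b\<^sup>2 * (H1_norm S (\<lambda>x. v x - \<psi> k x))\<^sup>2" for k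
  proof -
    have d: "(\<lambda>x. u x - \<phi> k x) \<in> H1 S" "(\<lambda>x. v x - \<psi> k x) \<in> H1 S"
      using H1_lincomb[OF S H(1) test_function_H1[OF S \<phi>(1)], of 1 "-1"]
        H1_lincomb[OF S H(2) test_function_H1[OF S \<psi>(1)], of 1 "-1"] by simp_all
    have "?d k = (\<lambda>x. a * (u x - \<phi> k x) + b * (v x - \<psi> k x))" by (auto simp: algebra_simps)
    then show ?thesis using H1_norm_lincomb[OF S d, of a b] by simp
  qed
  have lim: "(\<lambda>k. 2 * a\<^sup>2 * (H1_norm S (\<lambda>x. u x - \<phi> k x))\<^sup>2 + 2 * b\<^sup>2 * (H1_norm S (\<lambda>x. v x - \<psi> k x))\<^sup>2)
      \<longlonglongrightarrow> 2 * a\<^sup>2 * 0\<^sup>2 + 2 * b\<^sup>2 * 0\<^sup>2"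
    by (intro tendsto_intros \<phi> \<psi>)
  have "(\<lambda>k. (H1_norm S (?d k))\<^sup>2) \<longlonglongrightarrow> 0"
  proof (rule Lim_null_comparison)
    show "\<forall>\<^sub>F k in sequentially. norm ((H1_norm S (?d k))\<^sup>2)
      \<le> 2 * a\<^sup>2 * (H1_norm S (\<lambda>x. u x - \<phi> k x))\<^sup>2 + 2 * b\<^sup>2 * (H1_norm S (\<lambda>x. v x - \<psi> k x))\<^sup>2"
      using le by simp
  qed (use lim in simp)
  then have "(\<lambda>k. H1_norm S (?d k)) \<longlonglongrightarrow> 0"
    using tendsto_real_sqrt[of "\<lambda>k. (H1_norm S (?d k))\<^sup>2" 0]
    by (simp add: H1_norm_def L2_inner_nonneg grad_inner_nonneg)
  moreover have "(\<lambda>x. a * \<phi> k x + b * \<psi> k x) \<in> test_functions S" for k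
    by (intro test_functions_lincomb \<phi> \<psi>)
  ultimately have "\<exists>\<xi>. (\<forall>k. \<xi> k \<in> test_functions S)
      \<and> (\<lambda>k. H1_norm S (\<lambda>x. a * u x + b * v x - \<xi> k x)) \<longlonglongrightarrow> 0"
    by (intro exI[where x = "\<lambda>k x. a * \<phi> k x + b * \<psi> k x"] conjI allI)
  then show ?thesis using H1_lincomb[OF S H] unfolding H10_def by simp
qed

lemma H10_zero:
  assumes "open S" "bounded S" shows "(\<lambda>x. 0) \<in> H10 S"
proof -
  have "is_weak_grad S (\<lambda>x. 0) (\<lambda>x. 0)" "(\<lambda>x. 0) \<in> H1 S"
    using affine_weak_grad[OF assms, of 0 0] by simp_all
  then have "H1_norm S (\<lambda>x. 0 - 0) = 0"
    using grad_inner_eq[OF assms, of "\<lambda>x. 0" "\<lambda>x. 0" "\<lambda>x. 0" "\<lambda>x. 0"]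
    by (simp add: H1_norm_def L2_inner_def)
  then have "(\<forall>k. (\<lambda>x. 0) \<in> test_functions S) \<and> (\<lambda>k::nat. H1_norm S (\<lambda>x. 0 - 0)) \<longlonglongrightarrow> 0"
    using test_functions_zero by simp
  then have "\<exists>\<phi>. (\<forall>k. \<phi> k \<in> test_functions S) \<and> (\<lambda>k::nat. H1_norm S (\<lambda>x. 0 - \<phi> k x)) \<longlonglongrightarrow> 0"
    by (rule exI[where x = "\<lambda>k x. 0"])
  then show ?thesis using \<open>(\<lambda>x. 0) \<in> H1 S\<close> unfolding H10_def by blast
qed

lemma Linf_subset_L2:
  assumes f: "f \<in> Linf \<Omega>" and S: "open S" "bounded S" "S \<subseteq> \<Omega>" and \<Omega>: "open \<Omega>"
  shows "f \<in> L2 S"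
proof -
  have fin: "Linf_norm \<Omega> f < \<infinity>" and m: "f \<in> borel_measurable (lebesgue_on \<Omega>)"
    using f by (auto simp: Linf_def)
  obtain C where C: "Linf_norm \<Omega> f = ennreal C" "0 \<le> C"
    using fin by (cases "Linf_norm \<Omega> f") auto
  have "AE x in lebesgue_on \<Omega>. ennreal \<bar>f x\<bar> \<le> Linf_norm \<Omega> f"
    unfolding Linf_norm_def by (rule esssup_AE)
  then have "AE x in lebesgue_on \<Omega>. \<bar>f x\<bar> \<le> C"
    by eventually_elim (simp add: C)
  then have "AE x in lebesgue. x \<in> \<Omega> \<longrightarrow> \<bar>f x\<bar> \<le> C"
    using \<Omega> by (subst (asm) AE_restrict_space_iff) auto
  then have "AE x in lebesgue. x \<in> S \<longrightarrow> \<bar>f x\<bar> \<le> C"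
    by eventually_elim (use S(3) in auto)
  then have "AE x in lebesgue_on S. \<bar>f x\<bar> \<le> C"
    using S(1) by (subst AE_restrict_space_iff) auto
  then show ?thesis
    using L2_bounded bounded_open_lmeasurable[OF S(1,2)] measurable_restrict_mono[OF m S(3)] by blast
qed

section \<open>Variational inequalities in finite-dimensional function spaces\<close>

definition linear_space :: "('a \<Rightarrow> real) set \<Rightarrow> bool" where
  "linear_space X \<longleftrightarrow> (\<lambda>x. 0) \<in> X \<and> (\<forall>u\<in>X. \<forall>v\<in>X. \<forall>a b. (\<lambda>x. a * u x + b * v x) \<in> X)"

definition symmetric_bilinear ::
  "('a \<Rightarrow> real) set \<Rightarrow> (('a \<Rightarrow> real) \<Rightarrow> ('a \<Rightarrow> real) \<Rightarrow> real) \<Rightarrow> bool" where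
  "symmetric_bilinear X B \<longleftrightarrow> (\<forall>u\<in>X. \<forall>v\<in>X. B u v = B v u)
    \<and> (\<forall>u\<in>X. \<forall>v\<in>X. \<forall>w\<in>X. \<forall>a b. B (\<lambda>x. a * u x + b * v x) w = a * B u w + b * B v w)"

definition inner_product_on ::
  "('a \<Rightarrow> real) set \<Rightarrow> (('a \<Rightarrow> real) \<Rightarrow> ('a \<Rightarrow> real) \<Rightarrow> real) \<Rightarrow> bool" where
  "inner_product_on X B \<longleftrightarrow> symmetric_bilinear X B \<and> (\<forall>u\<in>X. u \<noteq> (\<lambda>x. 0) \<longrightarrow> 0 < B u u)"

definition linear_functional_on :: "('a \<Rightarrow> real) set \<Rightarrow> (('a \<Rightarrow> real) \<Rightarrow> real) \<Rightarrow> bool" where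
  "linear_functional_on X l \<longleftrightarrow> (\<forall>u\<in>X. \<forall>v\<in>X. \<forall>a b. l (\<lambda>x. a * u x + b * v x) = a * l u + b * l v)"

text \<open>
  For a linear space and a finite set of points this expresses that the dimension is finite
  without mentioning a basis: point evaluations embed the space into a power of the reals.
\<close>

definition separated_by :: "('a \<Rightarrow> real) set \<Rightarrow> 'a set \<Rightarrow> bool" where
  "separated_by X F \<longleftrightarrow> (\<forall>u\<in>X. (\<forall>x\<in>F. u x = 0) \<longrightarrow> u = (\<lambda>x. 0))"

lemma linear_spaceD:
  assumes "linear_space X"
  shows "(\<lambda>x. 0) \<in> X" "u \<in> X \<Longrightarrow> v \<in> X \<Longrightarrow> (\<lambda>x. a * u x + b * v x) \<in> X"
    "u \<in> X \<Longrightarrow> v \<in> X \<Longrightarrow> (\<lambda>x. u x - v x) \<in> X" "u \<in> X \<Longrightarrow> v \<in> X \<Longrightarrow> (\<lambda>x. u x + v x) \<in> X"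
    "u \<in> X \<Longrightarrow> (\<lambda>x. a * u x) \<in> X"
proof -
  have L: "(\<lambda>x. a * u x + b * v x) \<in> X" if "u \<in> X" "v \<in> X" for u v a b
    using assms that unfolding linear_space_def by blast
  show "(\<lambda>x. 0) \<in> X" using assms by (simp add: linear_space_def)
  show "u \<in> X \<Longrightarrow> v \<in> X \<Longrightarrow> (\<lambda>x. a * u x + b * v x) \<in> X" by (rule L)
  show "u \<in> X \<Longrightarrow> v \<in> X \<Longrightarrow> (\<lambda>x. u x - v x) \<in> X" using L[of u v 1 "-1"] by simp
  show "u \<in> X \<Longrightarrow> v \<in> X \<Longrightarrow> (\<lambda>x. u x + v x) \<in> X" using L[of u v 1 1] by simp
  show "u \<in> X \<Longrightarrow> (\<lambda>x. a * u x) \<in> X" using L[of u u a 0] by simp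
qed

lemma linear_functional_onD:
  assumes "linear_functional_on X l"
  shows "u \<in> X \<Longrightarrow> v \<in> X \<Longrightarrow> l (\<lambda>x. a * u x + b * v x) = a * l u + b * l v"
    "u \<in> X \<Longrightarrow> v \<in> X \<Longrightarrow> l (\<lambda>x. u x - v x) = l u - l v"
    "u \<in> X \<Longrightarrow> v \<in> X \<Longrightarrow> l (\<lambda>x. u x + v x) = l u + l v"
    "u \<in> X \<Longrightarrow> l (\<lambda>x. a * u x) = a * l u"
proof -
  have L: "l (\<lambda>x. a * u x + b * v x) = a * l u + b * l v" if "u \<in> X" "v \<in> X" for u v a b
    using assms that unfolding linear_functional_on_def by blast
  show "u \<in> X \<Longrightarrow> v \<in> X \<Longrightarrow> l (\<lambda>x. a * u x + b * v x) = a * l u + b * l v" by (rule L)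
  show "u \<in> X \<Longrightarrow> v \<in> X \<Longrightarrow> l (\<lambda>x. u x - v x) = l u - l v" using L[of u v 1 "-1"] by simp
  show "u \<in> X \<Longrightarrow> v \<in> X \<Longrightarrow> l (\<lambda>x. u x + v x) = l u + l v" using L[of u v 1 1] by simp
  show "u \<in> X \<Longrightarrow> l (\<lambda>x. a * u x) = a * l u" using L[of u u a 0] by simp
qed

lemma symmetric_bilinearD:
  assumes "symmetric_bilinear X B"
  shows "u \<in> X \<Longrightarrow> v \<in> X \<Longrightarrow> B u v = B v u"
    "w \<in> X \<Longrightarrow> linear_functional_on X (\<lambda>v. B v w)"
    "linear_space X \<Longrightarrow> w \<in> X \<Longrightarrow> linear_functional_on X (B w)"
proof -
  show S: "u \<in> X \<Longrightarrow> v \<in> X \<Longrightarrow> B u v = B v u" for u v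
    using assms by (auto simp: symmetric_bilinear_def)
  show L: "w \<in> X \<Longrightarrow> linear_functional_on X (\<lambda>v. B v w)" for w
    using assms by (simp add: symmetric_bilinear_def linear_functional_on_def)
  show "linear_functional_on X (B w)" if "linear_space X" "w \<in> X"
    unfolding linear_functional_on_def
  proof (intro ballI allI)
    fix u v a b assume uv: "u \<in> X" "v \<in> X"
    have "B w (\<lambda>x. a * u x + b * v x) = B (\<lambda>x. a * u x + b * v x) w"
      using that uv by (intro S linear_spaceD(2))
    also have "\<dots> = a * B u w + b * B v w"
      using linear_functional_onD(1)[OF L[OF that(2)] uv] .
    finally show "B w (\<lambda>x. a * u x + b * v x) = a * B w u + b * B w v"
      using S[OF uv(1) that(2)] S[OF uv(2) that(2)] by simp
  qed
qed

lemma linear_space_sum: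
  "linear_space X \<Longrightarrow> finite I \<Longrightarrow> (\<And>i. i \<in> I \<Longrightarrow> e i \<in> X) \<Longrightarrow> (\<lambda>x. \<Sum>i\<in>I. c i * e i x) \<in> X"
proof (rotate_tac 1, induction I rule: finite_induct)
  case empty
  then show ?case using linear_spaceD(1) by simp
next
  case (insert i I)
  then have "(\<lambda>x. c i * e i x) \<in> X" "(\<lambda>x. \<Sum>j\<in>I. c j * e j x) \<in> X"
    using linear_spaceD(5) by auto
  then show ?case using insert linear_spaceD(4)[of X] by simp
qed

lemma linear_functional_zero: "linear_space X \<Longrightarrow> linear_functional_on X l \<Longrightarrow> l (\<lambda>x. 0) = 0"
  using linear_functional_onD(4)[of X l "\<lambda>x. 0" 0] linear_spaceD(1) by auto

lemma linear_functional_sum: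
  assumes "linear_space X" "linear_functional_on X l"
  shows "finite I \<Longrightarrow> (\<And>i. i \<in> I \<Longrightarrow> e i \<in> X) \<Longrightarrow> l (\<lambda>x. \<Sum>i\<in>I. c i * e i x) = (\<Sum>i\<in>I. c i * l (e i))"
proof (induction I rule: finite_induct)
  case empty
  then show ?case using linear_functional_zero[OF assms] by simp
next
  case (insert i I)
  have "(\<lambda>x. c i * e i x) \<in> X" "(\<lambda>x. \<Sum>j\<in>I. c j * e j x) \<in> X"
    by (rule linear_spaceD(5)[OF assms(1)], use insert.prems in simp)
       (rule linear_space_sum[OF assms(1) insert.hyps(1)], use insert.prems in simp)
  then show ?case using insert linear_functional_onD[OF assms(2)] by simp
qed

lemma symmetric_bilinear_comp:
  assumes "symmetric_bilinear Y B" "\<And>u. u \<in> X \<Longrightarrow> \<pi> u \<in> Y"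
    "\<And>u v a b. u \<in> X \<Longrightarrow> v \<in> X \<Longrightarrow> \<pi> (\<lambda>x. a * u x + b * v x) = (\<lambda>x. a * \<pi> u x + b * \<pi> v x)"
  shows "symmetric_bilinear X (\<lambda>u v. B (\<pi> u) (\<pi> v))"
  using assms unfolding symmetric_bilinear_def by auto

lemma symmetric_bilinear_lincomb:
  assumes "symmetric_bilinear X A" "symmetric_bilinear X B"
  shows "symmetric_bilinear X (\<lambda>u v. c * A u v + d * B u v)"
  using assms unfolding symmetric_bilinear_def by (auto simp: algebra_simps)

lemma symmetric_bilinear_sum:
  "(\<And>i. i \<in> I \<Longrightarrow> symmetric_bilinear X (B i)) \<Longrightarrow> symmetric_bilinear X (\<lambda>u v. \<Sum>i\<in>I. B i u v)"
  unfolding symmetric_bilinear_def by (auto simp: sum.distrib sum_distrib_left intro!: sum.cong)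

lemma symmetric_bilinear_subset: "symmetric_bilinear Y B \<Longrightarrow> X \<subseteq> Y \<Longrightarrow> symmetric_bilinear X B"
  unfolding symmetric_bilinear_def by blast

lemma linear_functional_on_lincomb:
  "linear_functional_on X l \<Longrightarrow> linear_functional_on X k \<Longrightarrow> linear_functional_on X (\<lambda>v. c * l v + d * k v)"
  unfolding linear_functional_on_def by (auto simp: algebra_simps)

lemma linear_functional_on_sum:
  "(\<And>i. i \<in> I \<Longrightarrow> linear_functional_on X (l i)) \<Longrightarrow> linear_functional_on X (\<lambda>v. \<Sum>i\<in>I. l i v)"
  unfolding linear_functional_on_def by (auto simp: sum.distrib sum_distrib_left intro!: sum.cong)

definition orthonormal_basis ::
  "('a \<Rightarrow> real) set \<Rightarrow> (('a \<Rightarrow> real) \<Rightarrow> ('a \<Rightarrow> real) \<Rightarrow> real) \<Rightarrow> nat \<Rightarrow> (nat \<Rightarrow> 'a \<Rightarrow> real) \<Rightarrow> bool" where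
  "orthonormal_basis X B m e \<longleftrightarrow> (\<forall>i<m. e i \<in> X)
     \<and> (\<forall>i<m. \<forall>j<m. B (e i) (e j) = of_bool (i = j))
     \<and> (\<forall>u\<in>X. u = (\<lambda>x. \<Sum>i<m. B u (e i) * e i x))"

lemma orthonormal_basisD:
  assumes "orthonormal_basis X B m e"
  shows "i < m \<Longrightarrow> e i \<in> X" "i < m \<Longrightarrow> j < m \<Longrightarrow> B (e i) (e j) = of_bool (i = j)"
    "u \<in> X \<Longrightarrow> u = (\<lambda>x. \<Sum>i<m. B u (e i) * e i x)"
  using assms unfolding orthonormal_basis_def by blast+

text \<open>
  Gram-Schmidt by induction on the separating points.  The functions that vanish at one more point
  \<open>f\<close> form a subspace of codimension at most one, separated by the remaining points.  If some
  \<open>u\<close> of the space does not vanish at \<open>f\<close>, its component orthogonal to the subspace does not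
  either and completes the basis.
\<close>

lemma orthonormal_basis_exists:
  assumes "finite F" "linear_space X" "inner_product_on X B" "separated_by X F"
  shows "\<exists>m e. orthonormal_basis X B m e"
  using assms
proof (induction F arbitrary: X rule: finite_induct)
  case empty
  then have "\<forall>u\<in>X. u = (\<lambda>x. 0)" by (auto simp: separated_by_def)
  then have "orthonormal_basis X B 0 (\<lambda>_ _. 0)" by (auto simp: orthonormal_basis_def)
  then show ?case by blast
next
  case (insert f F)
  note X = insert.prems(1) and B = insert.prems(2) and sep = insert.prems(3)
  define Y where "Y = {u\<in>X. u f = 0}"
  have Y: "linear_space Y" using X unfolding linear_space_def Y_def by auto
  have BY: "inner_product_on Y B" using B unfolding inner_product_on_def symmetric_bilinear_def Y_def by auto
  have "separated_by Y F" using sep unfolding separated_by_def Y_def by auto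
  then obtain m e where ons: "orthonormal_basis Y B m e"
    using insert.IH[OF Y BY] by blast
  note e = orthonormal_basisD[OF ons]
  show ?case
  proof (cases "\<forall>u\<in>X. u f = 0")
    case True
    then have "Y = X" by (auto simp: Y_def)
    then show ?thesis using ons by blast
  next
    case False
    then obtain u where u: "u \<in> X" "u f \<noteq> 0" by blast
    have eX: "e i \<in> X" "e i f = 0" if "i < m" for i using e(1)[OF that] by (auto simp: Y_def)
    have bil: "symmetric_bilinear X B" using B by (simp add: inner_product_on_def)
    note lin = symmetric_bilinearD(2)[OF bil]
    let ?s = "\<lambda>x. \<Sum>i<m. B u (e i) * e i x"
    have s: "?s \<in> X" using eX by (intro linear_space_sum X) auto
    \<comment> \<open>\<open>p\<close> is orthogonal to the subspace, and its value at \<open>f\<close> is that of \<open>u\<close>.\<close>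
    define p where "p x = u x - ?s x" for x
    have p: "p \<in> X" "p f \<noteq> 0"
      using linear_spaceD(3)[OF X u(1) s] u(2) eX(2) by (simp_all add: p_def[abs_def])
    have pe: "B p (e j) = 0" if j: "j < m" for j
    proof -
      have "B p (e j) = B u (e j) - B ?s (e j)"
        unfolding p_def using linear_functional_onD(2)[OF lin[OF eX(1)[OF j]] u(1) s] .
      also have "B ?s (e j) = (\<Sum>i<m. B u (e i) * B (e i) (e j))"
        using linear_functional_sum[OF X lin[OF eX(1)[OF j]], of "{..<m}" e] eX by simp
      also have "\<dots> = B u (e j)" using e(2) j by (simp add: if_distrib[of "(*) _"] of_bool_def cong: if_cong)
      finally show ?thesis by simp
    qed
    have "0 < B p p" using B p by (auto simp: inner_product_on_def fun_eq_iff)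
    define q where "q x = inverse (sqrt (B p p)) * p x" for x
    have q: "q \<in> X" using linear_spaceD(5)[OF X p(1)] by (simp add: q_def[abs_def])
    have qf: "q f \<noteq> 0" using p \<open>0 < B p p\<close> by (simp add: q_def)
    have Bq: "B q w = inverse (sqrt (B p p)) * B p w" if "w \<in> X" for w
      unfolding q_def using linear_functional_onD(4)[OF lin[OF that] p(1)] .
    have qe: "B q (e j) = 0" "B (e j) q = 0" if "j < m" for j
      using Bq[OF eX(1)[OF that]] pe[OF that] symmetric_bilinearD(1)[OF bil q eX(1)[OF that]] by auto
    have qq: "B q q = 1"
    proof -
      have "B q q = inverse (sqrt (B p p)) * (inverse (sqrt (B p p)) * B p p)"
        using Bq[OF q] Bq[OF p(1)] symmetric_bilinearD(1)[OF bil p(1) q] by simp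
      then show ?thesis using \<open>0 < B p p\<close>
        by (simp add: field_simps)
    qed
    define e' where "e' i = (if i < m then e i else q)" for i
    have "\<forall>i<Suc m. e' i \<in> X" using eX q by (auto simp: e'_def)
    moreover have "\<forall>i<Suc m. \<forall>j<Suc m. B (e' i) (e' j) = of_bool (i = j)"
      using e(2) qe qq by (auto simp: e'_def less_Suc_eq)
    moreover have "\<forall>w\<in>X. w = (\<lambda>x. \<Sum>i<Suc m. B w (e' i) * e' i x)"
    proof
      fix w assume w: "w \<in> X"
      \<comment> \<open>Subtracting the multiple of \<open>q\<close> with the same value at \<open>f\<close> moves \<open>w\<close> into the subspace.\<close>
      define y where "y x = 1 * w x + (- (w f / q f)) * q x" for x
      have "y \<in> X" unfolding y_def using X w q by (intro linear_spaceD)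
      then have y: "y \<in> Y" using qf by (simp add: Y_def y_def)
      have By: "B y v = B w v - w f / q f * B q v" if "v \<in> X" for v
        unfolding y_def using linear_functional_onD(1)[OF lin[OF that] w q, of 1 "- (w f / q f)"] by simp
      have "B y q = 0"
      proof -
        have "B y q = B (\<lambda>x. \<Sum>i<m. B y (e i) * e i x) q" using e(3)[OF y] by simp
        also have "\<dots> = (\<Sum>i<m. B y (e i) * B (e i) q)"
          using linear_functional_sum[OF X lin[OF q], of "{..<m}" e] eX by simp
        finally show ?thesis using qe by simp
      qed
      then have wq: "B w q = w f / q f" using By[OF q] qq by simp
      have "y = (\<lambda>x. \<Sum>i<m. B y (e i) * e i x)" by (rule e(3)[OF y])
      also have "\<dots> = (\<lambda>x. \<Sum>i<m. B w (e i) * e i x)"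
        using By[OF eX(1)] qe by (intro ext sum.cong) auto
      finally have yx: "y x = (\<Sum>i<m. B w (e i) * e i x)" for x by (rule fun_cong)
      have "w x = (\<Sum>i<m. B w (e i) * e i x) + B w q * q x" for x
        unfolding yx[symmetric] wq by (simp add: y_def)
      then show "w = (\<lambda>x. \<Sum>i<Suc m. B w (e' i) * e' i x)" by (auto simp: e'_def)
    qed
    ultimately have "orthonormal_basis X B (Suc m) e'" unfolding orthonormal_basis_def by blast
    then show ?thesis by blast
  qed
qed

lemma riesz_representation:
  assumes F: "finite F" and X: "linear_space X" and ip: "inner_product_on X B" and sep: "separated_by X F"
    and l: "linear_functional_on X l"
  shows "\<exists>r\<in>X. \<forall>v\<in>X. B r v = l v"
proof -
  have bil: "symmetric_bilinear X B" using ip by (simp add: inner_product_on_def)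
  obtain m e where "orthonormal_basis X B m e"
    using orthonormal_basis_exists[OF F X ip sep] by blast
  note e = orthonormal_basisD[OF this]
  let ?r = "\<lambda>x. \<Sum>i<m. l (e i) * e i x"
  have "B ?r v = l v" if v: "v \<in> X" for v
  proof -
    have "B ?r v = (\<Sum>i<m. l (e i) * B (e i) v)"
      using linear_functional_sum[OF X symmetric_bilinearD(2)[OF bil v], of "{..<m}" e] e(1) by simp
    also have "\<dots> = l (\<lambda>x. \<Sum>i<m. B v (e i) * e i x)"
      using linear_functional_sum[OF X l, of "{..<m}" e] e(1) symmetric_bilinearD(1)[OF bil v e(1)]
      by (simp add: mult.commute[of "l _"])
    also have "\<dots> = l v" using e(3)[OF v] by simp
    finally show ?thesis .
  qed
  moreover have "?r \<in> X" using X e(1) by (intro linear_space_sum) auto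
  ultimately show ?thesis by blast
qed

lemma symmetric_bilinear_square:
  assumes X: "linear_space X" and B: "symmetric_bilinear X B" and uv: "u \<in> X" "v \<in> X"
  shows "B (\<lambda>x. a * u x + b * v x) (\<lambda>x. a * u x + b * v x)
       = a\<^sup>2 * B u u + 2 * a * b * B u v + b\<^sup>2 * B v v"
proof -
  let ?w = "\<lambda>x. a * u x + b * v x"
  have w: "?w \<in> X" using X uv by (intro linear_spaceD)
  have "B ?w ?w = a * B u ?w + b * B v ?w"
    using linear_functional_onD(1)[OF symmetric_bilinearD(2)[OF B w] uv] .
  also have "B u ?w = a * B u u + b * B u v"
    using linear_functional_onD(1)[OF symmetric_bilinearD(3)[OF B X uv(1)] uv] .
  also have "B v ?w = a * B u v + b * B v v"
    using linear_functional_onD(1)[OF symmetric_bilinearD(3)[OF B X uv(2)] uv]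
      symmetric_bilinearD(1)[OF B uv] by simp
  finally show ?thesis by (simp add: power2_eq_square algebra_simps)
qed

text \<open>
  With the Riesz representative \<open>r\<close> of \<open>l\<close>, the inequality says that \<open>W\<close> is the point of \<open>K\<close>
  closest to \<open>r\<close>.  A minimizing sequence is Cauchy by the parallelogram identity and the convexity
  of \<open>K\<close>; its coefficients in an orthonormal basis converge, and with them the functions at every
  point.  Closedness of \<open>K\<close> is therefore only needed for pointwise limits, which is
  convenient for cones given by sign conditions.
\<close>

lemma variational_inequality_ex1:
  assumes F: "finite F" and X: "linear_space X" and ip: "inner_product_on X B" and sep: "separated_by X F"
    and l: "linear_functional_on X l"
    and K: "K \<subseteq> X" "K \<noteq> {}"
    and convex: "\<And>u v t. u \<in> K \<Longrightarrow> v \<in> K \<Longrightarrow> 0 \<le> t \<Longrightarrow> t \<le> 1 \<Longrightarrow> (\<lambda>x. (1 - t) * u x + t * v x) \<in> K"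
    and closed: "\<And>s u. (\<And>k::nat. s k \<in> K) \<Longrightarrow> u \<in> X \<Longrightarrow> (\<And>x. (\<lambda>k. s k x) \<longlonglongrightarrow> u x) \<Longrightarrow> u \<in> K"
  shows "\<exists>!W. W \<in> K \<and> (\<forall>v\<in>K. l (\<lambda>x. v x - W x) \<le> B W (\<lambda>x. v x - W x))"
proof -
  have bil: "symmetric_bilinear X B" using ip by (simp add: inner_product_on_def)
  note lin = symmetric_bilinearD(2)[OF bil] and lin' = symmetric_bilinearD(3)[OF bil X]
  note sq = symmetric_bilinear_square[OF X bil]
  have pos: "0 \<le> B u u" if "u \<in> X" for u
  proof (cases "u = (\<lambda>x. 0)")
    case True then show ?thesis using linear_functional_zero[OF X lin[OF that]] by simp
  qed (use ip that in \<open>auto simp: inner_product_on_def less_imp_le\<close>)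
  obtain m e where "orthonormal_basis X B m e"
    using orthonormal_basis_exists[OF F X ip sep] by blast
  note e = orthonormal_basisD[OF this]
  have parseval: "B u v = (\<Sum>i<m. B u (e i) * B (e i) v)" if "u \<in> X" "v \<in> X" for u v
  proof -
    have "B u v = B (\<lambda>x. \<Sum>i<m. B u (e i) * e i x) v" using e(3)[OF that(1)] by simp
    then show ?thesis using linear_functional_sum[OF X lin[OF that(2)], of "{..<m}" e] e(1) by simp
  qed
  have bessel: "(B u (e i))\<^sup>2 \<le> B u u" if "u \<in> X" "i < m" for u i
  proof -
    have "B u u = (\<Sum>j<m. (B u (e j))\<^sup>2)"
      using parseval[OF that(1) that(1)] symmetric_bilinearD(1)[OF bil that(1) e(1)]
      by (simp add: power2_eq_square)
    then show ?thesis using that(2) member_le_sum[of i "{..<m}" "\<lambda>j. (B u (e j))\<^sup>2"] by simp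
  qed
  obtain r where r: "r \<in> X" and riesz: "\<And>v. v \<in> X \<Longrightarrow> B r v = l v"
    using riesz_representation[OF F X ip sep l] by blast
  define d where "d u = B (\<lambda>x. u x - r x) (\<lambda>x. u x - r x)" for u
  have KX: "u \<in> X" if "u \<in> K" for u using K that by blast
  have dX: "(\<lambda>x. u x - r x) \<in> X" if "u \<in> K" for u using linear_spaceD(3)[OF X KX[OF that] r] .
  have d0: "0 \<le> d u" if "u \<in> K" for u unfolding d_def using pos dX that by blast
  define D where "D = Inf (d ` K)"
  have bdd: "bdd_below (d ` K)" using d0 by (intro bdd_belowI2[of _ 0])
  have D: "D \<le> d u" if "u \<in> K" for u unfolding D_def using bdd that by (intro cInf_lower) auto
  have "\<exists>u\<in>K. d u < D + inverse (real (Suc k))" for k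
  proof -
    have "Inf (d ` K) < D + inverse (real (Suc k))" unfolding D_def by simp
    then show ?thesis using cInf_less_iff[OF _ bdd] K(2) by auto
  qed
  then obtain s where s: "\<And>k. s k \<in> K" "\<And>k. d (s k) < D + inverse (real (Suc k))" by metis
  have cauchy: "B (\<lambda>x. s j x - s k x) (\<lambda>x. s j x - s k x) \<le> 2 * inverse (real (Suc j)) + 2 * inverse (real (Suc k))" for j k
  proof -
    let ?a = "\<lambda>x. s j x - r x" and ?b = "\<lambda>x. s k x - r x"
    have ab: "?a \<in> X" "?b \<in> X" using dX s(1) by auto
    \<comment> \<open>The squared distance of the midpoint from \<open>r\<close> is at least the infimum \<open>D\<close>; this bounds the distance of \<open>s j\<close> and \<open>s k\<close>.\<close>
    have "(\<lambda>x. (1 - 1/2) * s j x + 1/2 * s k x) \<in> K" using convex[OF s(1) s(1), of "1/2"] by simp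
    then have "D \<le> d (\<lambda>x. (1 - 1/2) * s j x + 1/2 * s k x)" by (rule D)
    also have "(\<lambda>x. (1 - 1/2) * s j x + 1/2 * s k x - r x) = (\<lambda>x. 1/2 * ?a x + 1/2 * ?b x)"
      by (auto simp: field_simps)
    then have "d (\<lambda>x. (1 - 1/2) * s j x + 1/2 * s k x) = B (\<lambda>x. 1/2 * ?a x + 1/2 * ?b x) (\<lambda>x. 1/2 * ?a x + 1/2 * ?b x)"
      by (simp only: d_def)
    also have "\<dots> = (B ?a ?a + 2 * B ?a ?b + B ?b ?b) / 4"
      using sq[OF ab, of "1/2" "1/2"] by (simp add: power2_eq_square field_simps)
    finally have "4 * D \<le> B ?a ?a + 2 * B ?a ?b + B ?b ?b" by simp
    moreover have "(\<lambda>x. s j x - s k x) = (\<lambda>x. 1 * ?a x + (- 1) * ?b x)" by auto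
    then have "B (\<lambda>x. s j x - s k x) (\<lambda>x. s j x - s k x) = B ?a ?a - 2 * B ?a ?b + B ?b ?b"
      using sq[OF ab, of 1 "-1"] by simp
    ultimately show ?thesis using s(2)[of j] s(2)[of k] unfolding d_def by linarith
  qed
  have conv: "convergent (\<lambda>k. B (s k) (e i))" if i: "i < m" for i
  proof -
    have "Cauchy (\<lambda>k. B (s k) (e i))"
    proof (rule metric_CauchyI)
      fix \<epsilon> :: real assume "0 < \<epsilon>"
      then obtain N where N: "inverse (real (Suc N)) < \<epsilon>\<^sup>2 / 4" using reals_Archimedean[of "\<epsilon>\<^sup>2/4"] by auto
      have "dist (B (s j) (e i)) (B (s k) (e i)) < \<epsilon>" if "N \<le> j" "N \<le> k" for j k
      proof -
        have "inverse (real (Suc j)) \<le> inverse (real (Suc N))" "inverse (real (Suc k)) \<le> inverse (real (Suc N))"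
          using that by (auto intro!: le_imp_inverse_le)
        then have "B (\<lambda>x. s j x - s k x) (\<lambda>x. s j x - s k x) < \<epsilon>\<^sup>2"
          using cauchy[of j k] N by linarith
        moreover have "(B (\<lambda>x. s j x - s k x) (e i))\<^sup>2 \<le> B (\<lambda>x. s j x - s k x) (\<lambda>x. s j x - s k x)"
          using bessel[OF linear_spaceD(3)[OF X KX[OF s(1)] KX[OF s(1)]] i] .
        moreover have "B (\<lambda>x. s j x - s k x) (e i) = B (s j) (e i) - B (s k) (e i)"
          using linear_functional_onD(2)[OF lin[OF e(1)[OF i]] KX[OF s(1)] KX[OF s(1)]] .
        ultimately have "(B (s j) (e i) - B (s k) (e i))\<^sup>2 < \<epsilon>\<^sup>2" by simp
        then have "\<bar>B (s j) (e i) - B (s k) (e i)\<bar> < \<epsilon>"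
          using \<open>0 < \<epsilon>\<close> by (intro power2_less_imp_less[of "\<bar>_\<bar>" \<epsilon>]) auto
        then show ?thesis by (simp add: dist_real_def)
      qed
      then show "\<exists>N. \<forall>j\<ge>N. \<forall>k\<ge>N. dist (B (s j) (e i)) (B (s k) (e i)) < \<epsilon>" by blast
    qed
    then show ?thesis by (rule Cauchy_convergent)
  qed
  define c where "c i = lim (\<lambda>k. B (s k) (e i))" for i
  have c: "(\<lambda>k. B (s k) (e i)) \<longlonglongrightarrow> c i" if "i < m" for i
    using conv[OF that] unfolding c_def by (simp add: convergent_LIMSEQ_iff)
  define W where "W x = (\<Sum>i<m. c i * e i x)" for x
  have W: "W \<in> X" unfolding W_def using X e(1) by (intro linear_space_sum) auto
  have "(\<lambda>k. s k x) \<longlonglongrightarrow> W x" for x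
  proof -
    have "s k x = (\<Sum>i<m. B (s k) (e i) * e i x)" for k using e(3)[OF KX[OF s(1)]] by metis
    moreover have "(\<lambda>k. \<Sum>i<m. B (s k) (e i) * e i x) \<longlonglongrightarrow> (\<Sum>i<m. c i * e i x)"
      by (intro tendsto_sum tendsto_mult c tendsto_const) auto
    ultimately show ?thesis by (simp add: W_def)
  qed
  then have WK: "W \<in> K" by (rule closed[OF s(1) W])
  have We: "B W (e i) = c i" if "i < m" for i
  proof -
    have "B W (e i) = (\<Sum>j<m. c j * B (e j) (e i))"
      unfolding W_def using linear_functional_sum[OF X lin[OF e(1)[OF that]], of "{..<m}" e] e(1) by simp
    also have "\<dots> = c i" using e(2) that by (simp add: if_distrib[of "(*) _"] of_bool_def cong: if_cong)
    finally show ?thesis .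
  qed
  have dexp: "d u = (\<Sum>i<m. (B u (e i) - B r (e i))\<^sup>2)" if "u \<in> K" for u
  proof -
    have "d u = (\<Sum>i<m. (B (\<lambda>x. u x - r x) (e i))\<^sup>2)"
      unfolding d_def using parseval[OF dX dX, OF that that] symmetric_bilinearD(1)[OF bil dX[OF that] e(1)]
      by (simp add: power2_eq_square)
    then show ?thesis
      using linear_functional_onD(2)[OF lin[OF e(1)] KX[OF that] r] by simp
  qed
  have "(\<lambda>k. d (s k)) \<longlonglongrightarrow> d W"
    unfolding dexp[OF s(1)] dexp[OF WK]
    by (intro tendsto_intros) (use c We in auto)
  moreover have "(\<lambda>k. D + inverse (real (Suc k))) \<longlonglongrightarrow> D + 0"
    by (intro tendsto_intros LIMSEQ_inverse_real_of_nat)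
  ultimately have "d W \<le> D + 0"
    using s(2) by (intro LIMSEQ_le) (auto intro: less_imp_le)
  then have min: "d W \<le> d v" if "v \<in> K" for v using D[OF that] by simp
  have VI: "l (\<lambda>x. v x - W x) \<le> B W (\<lambda>x. v x - W x)" if v: "v \<in> K" for v
  proof -
    let ?z = "\<lambda>x. v x - W x" and ?w = "\<lambda>x. W x - r x"
    have z: "?z \<in> X" "?w \<in> X" using linear_spaceD(3)[OF X] KX[OF v] W r by auto
    \<comment> \<open>Minimality on the segment from \<open>W\<close> to \<open>v\<close>, divided by \<open>t\<close>; the limit \<open>t = 0\<close> is the inequality.\<close>
    have ineq: "0 \<le> 2 * B ?w ?z + t * B ?z ?z" if t: "0 < t" "t \<le> 1" for t
    proof -
      have "(\<lambda>x. (1 - t) * W x + t * v x) \<in> K" using convex[OF WK v] t by simp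
      then have "d W \<le> d (\<lambda>x. (1 - t) * W x + t * v x)" by (rule min)
      also have "(\<lambda>x. (1 - t) * W x + t * v x - r x) = (\<lambda>x. 1 * ?w x + t * ?z x)"
        by (auto simp: algebra_simps)
      then have "d (\<lambda>x. (1 - t) * W x + t * v x) = B (\<lambda>x. 1 * ?w x + t * ?z x) (\<lambda>x. 1 * ?w x + t * ?z x)"
        by (simp only: d_def)
      also have "\<dots> = d W + t * (2 * B ?w ?z + t * B ?z ?z)"
        using sq[OF z(2,1), of 1 t] by (simp add: d_def power2_eq_square algebra_simps)
      finally show ?thesis using t(1) by (simp add: zero_le_mult_iff)
    qed
    have "((\<lambda>t. 2 * B ?w ?z + t * B ?z ?z) \<longlongrightarrow> 2 * B ?w ?z + 0 * B ?z ?z) (at_right 0)"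
      by (intro tendsto_intros)
    moreover have "\<forall>\<^sub>F t in at_right 0. 0 \<le> 2 * B ?w ?z + t * B ?z ?z"
      using ineq by (intro eventually_at_rightI[of 0 1]) auto
    ultimately have "0 \<le> 2 * B ?w ?z + 0 * B ?z ?z"
      by (intro tendsto_lowerbound) auto
    moreover have "B ?w ?z = B W ?z - l ?z"
      using linear_functional_onD(2)[OF lin[OF z(1)] W r] riesz[OF z(1)] by simp
    ultimately show ?thesis by simp
  qed
  show ?thesis
  proof (rule ex1I[of _ W])
    show "W \<in> K \<and> (\<forall>v\<in>K. l (\<lambda>x. v x - W x) \<le> B W (\<lambda>x. v x - W x))" using WK VI by blast
    fix V assume V: "V \<in> K \<and> (\<forall>v\<in>K. l (\<lambda>x. v x - V x) \<le> B V (\<lambda>x. v x - V x))"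
    let ?z = "\<lambda>x. V x - W x"
    have VX: "V \<in> X" using V KX by blast
    have z: "?z \<in> X" using linear_spaceD(3)[OF X VX W] .
    have neg: "(\<lambda>x. W x - V x) = (\<lambda>x. -1 * ?z x)" by auto
    have "l ?z \<le> B W ?z" using VI V by blast
    moreover have "l (\<lambda>x. W x - V x) \<le> B V (\<lambda>x. W x - V x)" using V WK by blast
    then have "- l ?z \<le> - B V ?z"
      unfolding neg linear_functional_onD(4)[OF l z] linear_functional_onD(4)[OF lin'[OF VX] z] by simp
    moreover have "B ?z ?z = B V ?z - B W ?z"
      using linear_functional_onD(2)[OF lin[OF z] VX W] .
    ultimately have "B ?z ?z \<le> 0" by simp
    then have "?z = (\<lambda>x. 0)" using ip z unfolding inner_product_on_def by (meson not_le)
    then show "V = W" by (simp add: fun_eq_iff)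
  qed
qed

section \<open>Polygons and the local virtual element space\<close>

lemma P1I: "(\<lambda>x. c + g \<bullet> x) \<in> P1"
  by (auto simp: P1_def)

lemma P1_const: "(\<lambda>x. c) \<in> P1"
  using P1I[of c 0] by simp

lemma linear_space_P1: "linear_space P1"
proof -
  have "(\<lambda>x. a * (c + g \<bullet> x) + b * (d + h \<bullet> x)) = (\<lambda>x. (a * c + b * d) + (a *\<^sub>R g + b *\<^sub>R h) \<bullet> x)"
    for a b c d and g h :: "real^2"
    by (auto simp: algebra_simps)
  then have "(\<lambda>x. a * (c + g \<bullet> x) + b * (d + h \<bullet> x)) \<in> P1" for a b c d g h
    by (simp only: P1I)
  then show ?thesis using P1_const unfolding linear_space_def by (auto simp: P1_def)
qed

lemma separated_by_P1: "separated_by P1 (insert 0 Basis)"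
  unfolding separated_by_def
proof (intro ballI impI)
  fix u :: "real^2 \<Rightarrow> real" assume u: "u \<in> P1" "\<forall>x\<in>insert 0 Basis. u x = 0"
  obtain c g where cg: "u = (\<lambda>x. c + g \<bullet> x)" using u(1) by (auto simp: P1_def)
  have "c = 0" using bspec[OF u(2), of 0] by (simp add: cg)
  then have "g \<bullet> b = 0 \<bullet> b" if "b \<in> Basis" for b using bspec[OF u(2), of b] that by (simp add: cg)
  then have "g = 0" by (rule euclidean_eqI)
  then show "u = (\<lambda>x. 0)" using \<open>c = 0\<close> by (simp add: cg)
qed

lemma P1_eq_0_if_zero_on_open:
  assumes "q \<in> P1" "open S" "S \<noteq> {}" "\<And>x. x \<in> S \<Longrightarrow> q x = 0"
  shows "q = (\<lambda>x. 0)"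
proof -
  obtain c g where q: "q = (\<lambda>x. c + g \<bullet> x)" using assms(1) by (auto simp: P1_def)
  obtain x e where x: "x \<in> S" "e > 0" "cball x e \<subseteq> S"
    using assms(2,3) open_contains_cball by blast
  have "g = 0"
  proof (rule ccontr)
    assume "g \<noteq> 0"
    let ?y = "x + (e / norm g) *\<^sub>R g"
    have "?y \<in> S" using x \<open>g \<noteq> 0\<close> by (intro subsetD[OF x(3)]) (simp add: dist_norm)
    then have "g \<bullet> ?y = g \<bullet> x" using assms(4)[of ?y] assms(4)[OF x(1)] by (simp add: q)
    then show False using \<open>g \<noteq> 0\<close> x(2) by (simp add: inner_add_right)
  qed
  then show ?thesis using assms(4)[OF x(1)] by (simp add: q)
qed

lemma compact_edges: "compact (\<Union>(edges P))"
  unfolding edges_def edge_def by (intro compact_Union) auto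

lemma open_region: "open (region P)"
  unfolding region_def using open_inside[OF compact_imp_closed[OF compact_edges]] .

lemma bounded_region: "bounded (region P)"
  unfolding region_def using bounded_inside[OF compact_imp_bounded[OF compact_edges]] .

lemma area_pos: "region P \<noteq> {} \<Longrightarrow> 0 < area P"
  using open_not_negligible[OF open_region[of P]]
    negligible_iff_measure0[OF lmeasurable_open[OF bounded_region[of P] open_region[of P]]]
  by (simp add: area_def less_le)

lemma next_vertex_in: "i < length P \<Longrightarrow> next_vertex P i \<in> set P"
  unfolding next_vertex_def by (intro nth_mem mod_less_divisor) linarith

text \<open>
  If a nonzero affine function vanished at all vertices, the boundary of the polygon would lie on
  a line, and a line has no inside.
\<close>

lemma affine_eq_0_if_zero_at_vertices:
  assumes "region P \<noteq> {}" "q \<in> P1" "\<And>i. i < length P \<Longrightarrow> q (P ! i) = 0"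
  shows "q = (\<lambda>x. 0)"
proof -
  obtain c g where q: "q = (\<lambda>x. c + g \<bullet> x)" using assms(2) by (auto simp: P1_def)
  let ?H = "{x. g \<bullet> x = - c}"
  have "x \<in> ?H" if "x \<in> set P" for x
    using that assms(3) by (auto simp: q in_set_conv_nth eq_neg_iff_add_eq_0 add.commute)
  then have "edge P i \<subseteq> ?H" if "i < length P" for i
    unfolding edge_def using that next_vertex_in[OF that]
    by (intro closed_segment_subset convex_hyperplane) auto
  then have sub: "\<Union>(edges P) \<subseteq> ?H" by (auto simp: edges_def)
  have "region P - ?H \<subseteq> {}"
    using inside_mono[OF sub] inside_convex[OF convex_hyperplane[of g "- c"]] by (auto simp: region_def)
  then show ?thesis
    by (intro P1_eq_0_if_zero_on_open[OF assms(2) open_region assms(1)]) (auto simp: q)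
qed

lemma Vh_locD:
  assumes "v \<in> Vh_loc P"
  shows "v \<in> H1 (region P)" "continuous_on (closure (region P)) v" "v \<in> L2 (region P)"
  using assms by (auto simp: Vh_loc_def intro: H1_L2)

lemma P1_subset_Vh_loc: "P1 \<subseteq> Vh_loc P"
proof
  fix q assume q: "q \<in> P1"
  then obtain c g where "q = (\<lambda>x. c + g \<bullet> x)" by (auto simp: P1_def)
  then show "q \<in> Vh_loc P"
    using q affine_weak_grad(2)[OF open_region bounded_region, of c g P]
      weakly_harmonic_affine[OF open_region bounded_region, of P c g]
    by (auto simp: Vh_loc_def intro!: continuous_intros)
qed

lemma linear_space_Vh_loc: "linear_space (Vh_loc P)"
  unfolding linear_space_def
proof (intro conjI ballI allI)
  show "(\<lambda>x. 0) \<in> Vh_loc P" using P1_const P1_subset_Vh_loc by blast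
  fix u v a b assume u: "u \<in> Vh_loc P" and v: "v \<in> Vh_loc P"
  let ?w = "\<lambda>x. a * u x + b * v x"
  have "\<exists>q\<in>P1. \<forall>x\<in>e. ?w x = q x" if e: "e \<in> edges P" for e
  proof -
    obtain p q where "p \<in> P1" "q \<in> P1" "\<forall>x\<in>e. u x = p x" "\<forall>x\<in>e. v x = q x"
      using u v e unfolding Vh_loc_def by blast
    then show ?thesis
      by (intro bexI[of _ "\<lambda>x. a * p x + b * q x"]) (auto intro: linear_spaceD[OF linear_space_P1])
  qed
  moreover have "?w \<in> H1 (region P)"
    using Vh_locD[OF u] Vh_locD[OF v] by (intro H1_lincomb open_region bounded_region)
  moreover have "continuous_on (closure (region P)) ?w"
    using Vh_locD[OF u] Vh_locD[OF v] by (intro continuous_intros)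
  moreover have "weakly_harmonic (region P) ?w"
    using Vh_locD[OF u] Vh_locD[OF v] u v
    by (intro weakly_harmonic_lincomb open_region bounded_region) (auto simp: Vh_loc_def)
  ultimately show "?w \<in> Vh_loc P" by (simp add: Vh_loc_def)
qed

lemma symmetric_bilinear_L2: "symmetric_bilinear (L2 S) (L2_inner S)"
  unfolding symmetric_bilinear_def using L2_inner_lincomb L2_inner_sym by blast

lemma symmetric_bilinear_grad:
  "open S \<Longrightarrow> bounded S \<Longrightarrow> symmetric_bilinear (H1 S) (grad_inner S)"
  unfolding symmetric_bilinear_def using grad_inner_lincomb grad_inner_sym by blast

section \<open>The two projections\<close>

lemma vertex_inner_lincomb:
  "vertex_inner P (\<lambda>x. a * u x + b * v x) w = a * vertex_inner P u w + b * vertex_inner P v w"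
  by (simp add: vertex_inner_def sum.distrib sum_distrib_left algebra_simps)

lemma vertex_inner_sym: "vertex_inner P u v = vertex_inner P v u"
  by (simp add: vertex_inner_def mult.commute)

text \<open>
  The vertices are not collinear, so their values determine an affine function.
\<close>

lemma inner_product_vertex_inner:
  assumes "region P \<noteq> {}"
  shows "inner_product_on P1 (vertex_inner P)"
  unfolding inner_product_on_def
proof (intro conjI ballI impI)
  show "symmetric_bilinear P1 (vertex_inner P)"
    unfolding symmetric_bilinear_def using vertex_inner_lincomb vertex_inner_sym by blast
  fix q assume q: "q \<in> P1" "q \<noteq> (\<lambda>x. 0)"
  then obtain i where "i < length P" "q (P ! i) \<noteq> 0"
    using affine_eq_0_if_zero_at_vertices[OF assms q(1)] by blast
  then have "0 < (\<Sum>i<length P. q (P ! i) * q (P ! i))"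
    by (intro sum_pos2[of _ i]) (auto simp: zero_less_mult_iff)
  then show "0 < vertex_inner P q q" using area_pos[OF assms] by (simp add: vertex_inner_def)
qed

lemma proj_vertex_unique:
  assumes P: "region P \<noteq> {}" and p: "p \<in> P1" "\<And>q. q \<in> P1 \<Longrightarrow> vertex_inner P p q = vertex_inner P v q"
  shows "proj_vertex P v = p"
proof -
  note ip = inner_product_vertex_inner[OF P]
  have diff: "vertex_inner P (\<lambda>x. u x - w x) q = vertex_inner P u q - vertex_inner P w q" for u w q
    using vertex_inner_lincomb[of P 1 u "-1" w q] by simp
  show ?thesis unfolding proj_vertex_def
  proof (rule the_equality)
    show "p \<in> P1 \<and> (\<forall>q\<in>P1. vertex_inner P (\<lambda>x. v x - p x) q = 0)" using p by (simp add: diff)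
    fix r assume r: "r \<in> P1 \<and> (\<forall>q\<in>P1. vertex_inner P (\<lambda>x. v x - r x) q = 0)"
    let ?z = "\<lambda>x. r x - p x"
    have z: "?z \<in> P1" using r p by (intro linear_spaceD[OF linear_space_P1]) auto
    then have "vertex_inner P ?z ?z = 0" using r p(2)[OF z] by (simp add: diff)
    then have "?z = (\<lambda>x. 0)" using ip z unfolding inner_product_on_def by (metis less_irrefl)
    then show "r = p" by (simp add: fun_eq_iff)
  qed
qed

text \<open>
  Existence is Riesz representation of \<open>vertex_inner P v\<close> on the affine functions.
\<close>

lemma proj_vertex:
  assumes P: "region P \<noteq> {}"
  shows "proj_vertex P v \<in> P1" "q \<in> P1 \<Longrightarrow> vertex_inner P (proj_vertex P v) q = vertex_inner P v q"
proof -
  have "linear_functional_on P1 (vertex_inner P v)"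
    unfolding linear_functional_on_def
    using vertex_inner_lincomb[of P _ _ _ _ v] by (simp add: vertex_inner_sym[of P v])
  then obtain p where p: "p \<in> P1" "\<And>q. q \<in> P1 \<Longrightarrow> vertex_inner P p q = vertex_inner P v q"
    using riesz_representation[OF finite.insertI[OF finite_Basis] linear_space_P1
        inner_product_vertex_inner[OF P] separated_by_P1] by blast
  then have "proj_vertex P v = p" by (intro proj_vertex_unique[OF P])
  then show "proj_vertex P v \<in> P1" "q \<in> P1 \<Longrightarrow> vertex_inner P (proj_vertex P v) q = vertex_inner P v q"
    using p by auto
qed

lemma proj_vertex_lincomb:
  assumes P: "region P \<noteq> {}"
  shows "proj_vertex P (\<lambda>x. a * u x + b * v x) = (\<lambda>x. a * proj_vertex P u x + b * proj_vertex P v x)"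
  using proj_vertex[OF P] by (intro proj_vertex_unique[OF P] linear_spaceD[OF linear_space_P1])
    (auto simp: vertex_inner_lincomb)

text \<open>
  Integrability along the edges holds because the functions are affine there.
\<close>

lemma linear_functional_boundary_integral: "linear_functional_on (Vh_loc P) (boundary_integral P)"
  unfolding linear_functional_on_def
proof (intro ballI allI)
  fix u v a b assume u: "u \<in> Vh_loc P" and v: "v \<in> Vh_loc P"
  have int: "(\<lambda>t. w (linepath (P ! i) (next_vertex P i) t)) integrable_on {0..1}"
    if w: "w \<in> Vh_loc P" and i: "i < length P" for w i
  proof -
    have "edge P i \<in> edges P" using i by (auto simp: edges_def)
    then obtain q where q: "q \<in> P1" "\<forall>x\<in>edge P i. w x = q x" using w unfolding Vh_loc_def by blast
    then have "continuous_on UNIV q" by (auto simp: P1_def intro!: continuous_intros)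
    then have "continuous_on {0..1} (\<lambda>t. q (linepath (P ! i) (next_vertex P i) t))"
      by (rule continuous_on_compose2) (auto intro: continuous_on_linepath)
    then have "(\<lambda>t. q (linepath (P ! i) (next_vertex P i) t)) integrable_on {0..1}"
      by (rule integrable_continuous_interval)
    then show ?thesis
      by (rule integrable_eq) (use q(2) in \<open>auto simp: edge_def linepath_in_path\<close>)
  qed
  have "integral {0..1} (\<lambda>t. a * u (linepath (P ! i) (next_vertex P i) t) + b * v (linepath (P ! i) (next_vertex P i) t))
     = a * integral {0..1} (\<lambda>t. u (linepath (P ! i) (next_vertex P i) t))
     + b * integral {0..1} (\<lambda>t. v (linepath (P ! i) (next_vertex P i) t))" if "i < length P" for i
    using int[OF u that] int[OF v that]
    by (subst Henstock_Kurzweil_Integration.integral_add) (auto intro: integrable_on_mult_right)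
  then show "boundary_integral P (\<lambda>x. a * u x + b * v x) = a * boundary_integral P u + b * boundary_integral P v"
    by (simp add: boundary_integral_def sum.distrib[symmetric] sum_distrib_left algebra_simps)
qed

text \<open>
  The constant gradient of the projection \<open>proj_grad\<close>.
\<close>

definition mean_weak_grad :: "polygon \<Rightarrow> (real^2 \<Rightarrow> real) \<Rightarrow> real^2" where
  "mean_weak_grad P v = (1 / area P) *\<^sub>R (\<integral>x. weak_grad (region P) v x \<partial>lebesgue_on (region P))"

lemma mean_weak_grad_lincomb:
  assumes "u \<in> H1 (region P)" "v \<in> H1 (region P)"
  shows "mean_weak_grad P (\<lambda>x. a * u x + b * v x) = a *\<^sub>R mean_weak_grad P u + b *\<^sub>R mean_weak_grad P v"
proof -
  let ?S = "region P"
  note ob = open_region[of P] bounded_region[of P]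
  note int = weak_grad_vector_integrable[OF ob is_weak_grad_weak_grad]
  have "(\<integral>x. weak_grad ?S (\<lambda>x. a * u x + b * v x) x \<partial>lebesgue_on ?S)
      = (\<integral>x. a *\<^sub>R weak_grad ?S u x + b *\<^sub>R weak_grad ?S v x \<partial>lebesgue_on ?S)"
  proof (rule integral_cong_AE)
    show "weak_grad ?S (\<lambda>x. a * u x + b * v x) \<in> borel_measurable (lebesgue_on ?S)"
      using weak_grad_measurable[OF is_weak_grad_weak_grad[OF H1_lincomb[OF ob assms]]] .
    show "(\<lambda>x. a *\<^sub>R weak_grad ?S u x + b *\<^sub>R weak_grad ?S v x) \<in> borel_measurable (lebesgue_on ?S)"
      using weak_grad_measurable[OF is_weak_grad_weak_grad[OF assms(1)]] weak_grad_measurable[OF is_weak_grad_weak_grad[OF assms(2)]]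
      by (intro borel_measurable_add borel_measurable_scaleR) auto
  qed (rule weak_grad_lincomb[OF ob assms])
  also have "\<dots> = a *\<^sub>R (\<integral>x. weak_grad ?S u x \<partial>lebesgue_on ?S) + b *\<^sub>R (\<integral>x. weak_grad ?S v x \<partial>lebesgue_on ?S)"
    using int[OF assms(1)] int[OF assms(2)] by simp
  finally show ?thesis by (simp add: mean_weak_grad_def scaleR_add_right mult.commute)
qed

lemma perimeter_pos:
  assumes "simple_polygon P"
  shows "0 < boundary_integral P (\<lambda>x. 1)"
proof -
  have P: "3 \<le> length P" "distinct P" using assms by (auto simp: simple_polygon_def)
  have len: "0 < length P" "1 < length P" using P(1) by linarith+
  moreover have "P ! 0 \<noteq> next_vertex P 0"
    using nth_eq_iff_index_eq[OF P(2) len] len(2) by (simp add: next_vertex_def)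
  ultimately show ?thesis
    unfolding boundary_integral_def by (intro sum_pos2[of _ 0]) auto
qed

text \<open>
  Testing with affine functions only sees the slope: the orthogonality condition says that the
  slope of the projection is the mean of the weak gradient.  The boundary condition then
  determines the constant, because the perimeter is positive.
\<close>

lemma proj_grad_eq:
  assumes P: "simple_polygon P" "region P \<noteq> {}" and v: "v \<in> Vh_loc P"
  defines "g \<equiv> mean_weak_grad P v"
  shows "proj_grad P v = (\<lambda>x. (boundary_integral P v - boundary_integral P (\<lambda>x. g \<bullet> x))
           / boundary_integral P (\<lambda>x. 1) + g \<bullet> x)"
proof -
  let ?S = "region P" and ?b = "boundary_integral P"
  note ob = open_region[of P] bounded_region[of P]
  have vH: "v \<in> H1 ?S" using Vh_locD[OF v] by simp
  have grad: "grad_inner ?S (\<lambda>x. (c + w \<bullet> x) - v x) (\<lambda>x. d + y \<bullet> x) = area P * ((w - g) \<bullet> y)" for c w d y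
  proof -
    have "is_weak_grad ?S (\<lambda>x. 1 * (c + w \<bullet> x) + (- 1) * v x) (\<lambda>x. 1 *\<^sub>R w + (- 1) *\<^sub>R weak_grad ?S v x)"
      using vH by (intro is_weak_grad_lincomb ob affine_weak_grad(1) is_weak_grad_weak_grad H1_L2 L2_affine)
    then have wg: "is_weak_grad ?S (\<lambda>x. (c + w \<bullet> x) - v x) (\<lambda>x. w - weak_grad ?S v x)" by simp
    have int: "integrable (lebesgue_on ?S) (weak_grad ?S v)"
      using weak_grad_vector_integrable[OF ob is_weak_grad_weak_grad[OF vH]] .
    interpret finite_measure "lebesgue_on ?S"
      by (intro finite_measure_lebesgue_on bounded_open_lmeasurable ob)
    have m: "measure (lebesgue_on ?S) ?S = area P"
      using lmeasurable_open[OF ob(2,1)] by (simp add: area_def measure_restrict_space fmeasurableD)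
    have "grad_inner ?S (\<lambda>x. (c + w \<bullet> x) - v x) (\<lambda>x. d + y \<bullet> x)
        = (\<integral>x. (w - weak_grad ?S v x) \<bullet> y \<partial>lebesgue_on ?S)"
      using wg affine_weak_grad(1)[OF ob] by (rule grad_inner_eq[OF ob])
    also have "\<dots> = (area P *\<^sub>R w - (\<integral>x. weak_grad ?S v x \<partial>lebesgue_on ?S)) \<bullet> y"
      using int by (simp add: m inner_diff_left)
    also have "\<dots> = area P * ((w - g) \<bullet> y)"
      using area_pos[OF P(2)] by (simp add: g_def mean_weak_grad_def inner_diff_left algebra_simps)
    finally show ?thesis .
  qed
  have A: "(\<lambda>x. c + w \<bullet> x) \<in> Vh_loc P" for c w using P1I P1_subset_Vh_loc by blast
  have bdry: "?b (\<lambda>x. (c + w \<bullet> x) - v x) = c * ?b (\<lambda>x. 1) + ?b (\<lambda>x. w \<bullet> x) - ?b v" for c w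
  proof -
    note L = linear_functional_boundary_integral[of P]
    have "?b (\<lambda>x. (c + w \<bullet> x) - v x) = ?b (\<lambda>x. c + w \<bullet> x) - ?b v"
      using linear_functional_onD(2)[OF L A v] .
    also have "?b (\<lambda>x. c + w \<bullet> x) = c * ?b (\<lambda>x. 1) + ?b (\<lambda>x. w \<bullet> x)"
      using linear_functional_onD(1)[OF L A[of 1 0] A[of 0 w], of c 1] by simp
    finally show ?thesis .
  qed
  let ?c = "(?b v - ?b (\<lambda>x. g \<bullet> x)) / ?b (\<lambda>x. 1)"
  have char: "(\<forall>q\<in>P1. grad_inner ?S (\<lambda>x. (c + w \<bullet> x) - v x) q = 0) \<and> ?b (\<lambda>x. (c + w \<bullet> x) - v x) = 0
      \<longleftrightarrow> w = g \<and> c = ?c" for c w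
  proof -
    have "(\<forall>q\<in>P1. grad_inner ?S (\<lambda>x. (c + w \<bullet> x) - v x) q = 0) \<longleftrightarrow> w = g"
    proof
      assume "\<forall>q\<in>P1. grad_inner ?S (\<lambda>x. (c + w \<bullet> x) - v x) q = 0"
      then have "grad_inner ?S (\<lambda>x. (c + w \<bullet> x) - v x) (\<lambda>x. 0 + (w - g) \<bullet> x) = 0"
        using P1I by blast
      then have "(w - g) \<bullet> (w - g) = 0" using area_pos[OF P(2)] unfolding grad by simp
      then show "w = g" by simp
    next
      assume "w = g"
      then show "\<forall>q\<in>P1. grad_inner ?S (\<lambda>x. (c + w \<bullet> x) - v x) q = 0"
        by (auto simp: P1_def grad)
    qed
    moreover have "?b (\<lambda>x. (c + g \<bullet> x) - v x) = 0 \<longleftrightarrow> c = ?c"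
      using perimeter_pos[OF P(1)] by (auto simp: bdry field_simps)
    ultimately show ?thesis by blast
  qed
  show ?thesis unfolding proj_grad_def
  proof (rule the_equality)
    show "(\<lambda>x. ?c + g \<bullet> x) \<in> P1 \<and> (\<forall>q\<in>P1. grad_inner ?S (\<lambda>x. (?c + g \<bullet> x) - v x) q = 0)
        \<and> ?b (\<lambda>x. (?c + g \<bullet> x) - v x) = 0"
      using char[of ?c g] P1I by blast
    fix p assume p: "p \<in> P1 \<and> (\<forall>q\<in>P1. grad_inner ?S (\<lambda>x. p x - v x) q = 0) \<and> ?b (\<lambda>x. p x - v x) = 0"
    then obtain c w where "p = (\<lambda>x. c + w \<bullet> x)" by (auto simp: P1_def)
    then show "p = (\<lambda>x. ?c + g \<bullet> x)" using p char[of c w] by simp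
  qed
qed

lemma proj_grad_in_P1:
  "simple_polygon P \<Longrightarrow> region P \<noteq> {} \<Longrightarrow> v \<in> Vh_loc P \<Longrightarrow> proj_grad P v \<in> P1"
  by (simp add: proj_grad_eq P1I)

lemma proj_grad_lincomb:
  assumes P: "simple_polygon P" "region P \<noteq> {}" and u: "u \<in> Vh_loc P" and v: "v \<in> Vh_loc P"
  shows "proj_grad P (\<lambda>x. a * u x + b * v x) = (\<lambda>x. a * proj_grad P u x + b * proj_grad P v x)"
proof -
  let ?b = "boundary_integral P" and ?g = "mean_weak_grad P"
  let ?w = "\<lambda>x. a * u x + b * v x"
  note L = linear_functional_onD(1)[OF linear_functional_boundary_integral[of P]]
  have w: "?w \<in> Vh_loc P" using u v by (intro linear_spaceD[OF linear_space_Vh_loc])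
  have g: "?g ?w = a *\<^sub>R ?g u + b *\<^sub>R ?g v"
    using Vh_locD[OF u] Vh_locD[OF v] by (intro mean_weak_grad_lincomb)
  have A: "(\<lambda>x. y \<bullet> x) \<in> Vh_loc P" for y using P1I[of 0 y] P1_subset_Vh_loc by auto
  have bg: "?b (\<lambda>x. ?g ?w \<bullet> x) = a * ?b (\<lambda>x. ?g u \<bullet> x) + b * ?b (\<lambda>x. ?g v \<bullet> x)"
    using L[OF A A] by (simp add: g inner_add_left)
  have bw: "?b ?w = a * ?b u + b * ?b v" using L[OF u v] .
  have eq: "(?b ?w - ?b (\<lambda>x. ?g ?w \<bullet> x)) / ?b (\<lambda>x. 1)
      = a * ((?b u - ?b (\<lambda>x. ?g u \<bullet> x)) / ?b (\<lambda>x. 1)) + b * ((?b v - ?b (\<lambda>x. ?g v \<bullet> x)) / ?b (\<lambda>x. 1))"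
    unfolding bw bg by (simp add: algebra_simps diff_divide_distrib add_divide_distrib)
  show ?thesis
    unfolding proj_grad_eq[OF P w] proj_grad_eq[OF P u] proj_grad_eq[OF P v]
    by (rule ext, subst eq) (simp add: g inner_add_left distrib_left)
qed

section \<open>The discrete forms and one step of the scheme\<close>

text \<open>
  If \<open>r\<close> were negative, the sum of the values at \<open>s\<close> and \<open>-s\<close> with \<open>s\<^sup>2 = p / (- r)\<close> would
  be zero.
\<close>

lemma nonneg_leading_coeff:
  fixes p q r :: real
  assumes "\<And>t. 0 < p + 2 * t * q + t\<^sup>2 * r"
  shows "0 \<le> r"
proof (rule ccontr)
  assume "\<not> 0 \<le> r"
  then have r: "r < 0" by simp
  have p: "0 < p" using assms[of 0] by simp
  define s where "s = sqrt (p / - r)"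
  have "0 \<le> p / - r" using p r by (intro divide_nonneg_pos) auto
  then have "s\<^sup>2 = p / - r" unfolding s_def by (rule real_sqrt_pow2)
  then have "s\<^sup>2 * r = - p" using r by (simp add: field_simps)
  then show False using assms[of s] assms[of "- s"] by simp
qed

text \<open>
  Positivity is given only for functions that do not vanish in the open element.  A function
  \<open>v\<close> that does vanish there can be added, with any factor \<open>t\<close>, to the constant 1 without losing
  positivity; the quadratic polynomial in \<open>t\<close> obtained in this way forces \<open>S v v\<close> to be
  nonnegative.  The last claim is unisolvence of the vertex values: they determine \<open>S v v\<close>, so if
  they vanish, \<open>S v v\<close> is \<open>S 0 0 = 0\<close>.
\<close>

lemma computable_spd_properties:
  assumes S: "computable_spd P S" and P: "region P \<noteq> {}"
  shows "symmetric_bilinear (Vh_loc P) S"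
    "v \<in> Vh_loc P \<Longrightarrow> 0 \<le> S v v"
    "v \<in> Vh_loc P \<Longrightarrow> S v v = 0 \<Longrightarrow> x \<in> region P \<Longrightarrow> v x = 0"
    "v \<in> Vh_loc P \<Longrightarrow> (\<And>y. y \<in> set P \<Longrightarrow> v y = 0) \<Longrightarrow> x \<in> region P \<Longrightarrow> v x = 0"
proof -
  note X = linear_space_Vh_loc[of P]
  show sb: "symmetric_bilinear (Vh_loc P) S"
    using S unfolding computable_spd_def symmetric_bilinear_def by blast
  have pos: "0 < S v v" if "v \<in> Vh_loc P" "x \<in> region P" "v x \<noteq> 0" for v x
    using S that unfolding computable_spd_def by blast
  show "v x = 0" if "v \<in> Vh_loc P" "S v v = 0" "x \<in> region P"
    using pos[OF that(1,3)] that(2) by auto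
  show "0 \<le> S v v" if v: "v \<in> Vh_loc P" for v
  proof (cases "\<exists>x\<in>region P. v x \<noteq> 0")
    case True
    then show ?thesis using pos[OF v] by (auto intro: less_imp_le)
  next
    case False
    obtain x where x: "x \<in> region P" using P by blast
    have one: "(\<lambda>x. 1) \<in> Vh_loc P" using P1_const P1_subset_Vh_loc by blast
    have "0 < S (\<lambda>x. 1) (\<lambda>x. 1) + 2 * t * S (\<lambda>x. 1) v + t\<^sup>2 * S v v" for t
    proof -
      have "(\<lambda>x. 1 * 1 + t * v x) \<in> Vh_loc P" using linear_spaceD(2)[OF X one v] .
      then have "0 < S (\<lambda>x. 1 * 1 + t * v x) (\<lambda>x. 1 * 1 + t * v x)"
        using x False by (intro pos) auto
      then show ?thesis unfolding symmetric_bilinear_square[OF X sb one v] by simp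
    qed
    then show ?thesis by (rule nonneg_leading_coeff)
  qed
  show "v x = 0" if v: "v \<in> Vh_loc P" "\<And>y. y \<in> set P \<Longrightarrow> v y = 0" and x: "x \<in> region P"
  proof -
    have z: "(\<lambda>x. 0) \<in> Vh_loc P" using linear_spaceD(1)[OF X] .
    have "\<forall>y\<in>set P. v y = (\<lambda>x. 0) y \<and> v y = (\<lambda>x. 0) y" using v(2) by simp
    then have "S v v = S (\<lambda>x. 0) (\<lambda>x. 0)"
      using S[unfolded computable_spd_def, THEN conjunct2, THEN conjunct2, THEN conjunct2] v(1) z by meson
    also have "\<dots> = 0"
      using linear_functional_zero[OF X symmetric_bilinearD(2)[OF sb z]] .
    finally show ?thesis using pos[OF v(1) x] by auto
  qed
qed

lemma diff_P1_Vh_loc: "v \<in> Vh_loc P \<Longrightarrow> p \<in> P1 \<Longrightarrow> (\<lambda>x. v x - p x) \<in> Vh_loc P"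
  using linear_spaceD(3)[OF linear_space_Vh_loc] P1_subset_Vh_loc by blast

lemma symmetric_bilinear_mh_loc:
  assumes P: "region P \<noteq> {}" and S: "computable_spd P S"
  shows "symmetric_bilinear (Vh_loc P) (\<lambda>u v. L2_inner (region P) (proj_vertex P u) (proj_vertex P v)
      + S (\<lambda>x. u x - proj_vertex P u x) (\<lambda>x. v x - proj_vertex P v x))"
proof -
  have "symmetric_bilinear (Vh_loc P) (\<lambda>u v. L2_inner (region P) (proj_vertex P u) (proj_vertex P v))"
    by (rule symmetric_bilinear_comp[OF symmetric_bilinear_L2])
      (use proj_vertex(1)[OF P] P1_subset_Vh_loc Vh_locD(3) in blast, rule proj_vertex_lincomb[OF P])
  moreover have "symmetric_bilinear (Vh_loc P)
      (\<lambda>u v. S (\<lambda>x. u x - proj_vertex P u x) (\<lambda>x. v x - proj_vertex P v x))"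
    by (rule symmetric_bilinear_comp[OF computable_spd_properties(1)[OF S P]])
      (use diff_P1_Vh_loc proj_vertex(1)[OF P] in blast, simp add: proj_vertex_lincomb[OF P] algebra_simps)
  ultimately show ?thesis using symmetric_bilinear_lincomb[of _ _ _ 1 1] by simp
qed

lemma symmetric_bilinear_ah_loc:
  assumes P: "simple_polygon P" "region P \<noteq> {}" and S: "computable_spd P S"
  shows "symmetric_bilinear (Vh_loc P) (\<lambda>u v. grad_inner (region P) (proj_grad P u) (proj_grad P v)
      + S (\<lambda>x. u x - proj_grad P u x) (\<lambda>x. v x - proj_grad P v x))"
proof -
  have "symmetric_bilinear (Vh_loc P) (\<lambda>u v. grad_inner (region P) (proj_grad P u) (proj_grad P v))"
    by (rule symmetric_bilinear_comp[OF symmetric_bilinear_grad[OF open_region bounded_region]])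
      (use proj_grad_in_P1[OF P] P1_subset_Vh_loc Vh_locD(1) in blast, rule proj_grad_lincomb[OF P])
  moreover have "symmetric_bilinear (Vh_loc P)
      (\<lambda>u v. S (\<lambda>x. u x - proj_grad P u x) (\<lambda>x. v x - proj_grad P v x))"
    by (rule symmetric_bilinear_comp[OF computable_spd_properties(1)[OF S P(2)]])
      (use diff_P1_Vh_loc proj_grad_in_P1[OF P] in blast, simp add: proj_grad_lincomb[OF P] algebra_simps)
  ultimately show ?thesis using symmetric_bilinear_lincomb[of _ _ _ 1 1] by simp
qed

text \<open>
  An affine function that vanishes almost everywhere in \<open>S\<close> vanishes everywhere in \<open>S\<close>, since a
  nonempty open set is not a null set.
\<close>

lemma P1_eq_0_if_L2_inner_0:
  assumes "open S" "bounded S" "S \<noteq> {}" "p \<in> P1" "L2_inner S p p = 0"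
  shows "p = (\<lambda>x. 0)"
proof -
  have cont: "continuous_on UNIV p" using assms(4) by (auto simp: P1_def intro!: continuous_intros)
  have "p \<in> L2 S" using assms by (auto simp: P1_def intro: L2_affine)
  then have "AE x in lebesgue_on S. p x * p x = 0"
    using assms(5) by (subst integral_nonneg_eq_0_iff_AE[symmetric])
      (auto simp: L2_inner_def L2_prod_integrable)
  then have "AE x in lebesgue. \<not> (x \<in> S \<and> p x \<noteq> 0)"
    using assms(1) by (subst (asm) AE_restrict_space_iff) (auto elim!: eventually_mono)
  then have ae: "AE x in lebesgue. x \<notin> {x \<in> S. p x \<noteq> 0}" by simp
  have op: "open {x \<in> S. p x \<noteq> 0}"
  proof -
    have "open (p -` (- {0}))" using cont by (intro open_vimage) auto
    then have "open (S \<inter> p -` (- {0}))" using assms(1) by blast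
    moreover have "S \<inter> p -` (- {0}) = {x \<in> S. p x \<noteq> 0}" by auto
    ultimately show ?thesis by simp
  qed
  then have "negligible {x \<in> S. p x \<noteq> 0}"
    using ae AE_iff_null_sets[of "{x \<in> S. p x \<noteq> 0}" lebesgue] by (simp add: negligible_iff_null_sets)
  then have "{x \<in> S. p x \<noteq> 0} = {}" using open_not_negligible[OF op] by blast
  then show ?thesis using P1_eq_0_if_zero_on_open[OF assms(4,1,3)] by blast
qed

text \<open>
  Both summands are nonnegative.  If the first one vanishes, \<open>v\<close> equals its remainder \<open>r\<close>, and the
  second one controls \<open>r\<close>.
\<close>

lemma mh_loc_definite:
  assumes P: "region P \<noteq> {}" and S: "computable_spd P S" and v: "v \<in> Vh_loc P"
  defines "r \<equiv> \<lambda>x. v x - proj_vertex P v x"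
  defines "e \<equiv> L2_inner (region P) (proj_vertex P v) (proj_vertex P v) + S r r"
  shows "0 \<le> e" "e = 0 \<Longrightarrow> x \<in> region P \<Longrightarrow> v x = 0"
proof -
  have r: "r \<in> Vh_loc P" unfolding r_def using diff_P1_Vh_loc[OF v proj_vertex(1)[OF P]] .
  note nn = L2_inner_nonneg[of "region P" "proj_vertex P v"] computable_spd_properties(2)[OF S P r]
  show "0 \<le> e" using nn by (simp add: e_def)
  assume "e = 0" and x: "x \<in> region P"
  then have "L2_inner (region P) (proj_vertex P v) (proj_vertex P v) = 0" "S r r = 0"
    using nn by (auto simp: e_def)
  then have "proj_vertex P v = (\<lambda>x. 0)" "r x = 0"
    using P1_eq_0_if_L2_inner_0[OF open_region bounded_region P proj_vertex(1)[OF P]]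
      computable_spd_properties(3)[OF S P r _ x] by auto
  then show "v x = 0" by (simp add: r_def)
qed

lemma linear_space_Vh:
  assumes "open \<Omega>" "bounded \<Omega>" shows "linear_space (Vh \<Omega> M)"
  unfolding linear_space_def
proof (intro conjI ballI allI)
  show "(\<lambda>x. 0) \<in> Vh \<Omega> M"
    using H10_zero[OF assms] linear_spaceD(1)[OF linear_space_Vh_loc] by (simp add: Vh_def)
  fix u v a b assume u: "u \<in> Vh \<Omega> M" and v: "v \<in> Vh \<Omega> M"
  then show "(\<lambda>x. a * u x + b * v x) \<in> Vh \<Omega> M"
    using H10_lincomb[OF assms, of u v a b] linear_spaceD(2)[OF linear_space_Vh_loc, of u _ v a b]
    by (simp add: Vh_def)
qed

lemma Vh_Vh_loc: "v \<in> Vh \<Omega> M \<Longrightarrow> P \<in> M \<Longrightarrow> v \<in> Vh_loc P"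
  by (simp add: Vh_def)

text \<open>
  The closed elements cover \<open>closure \<Omega>\<close> and \<open>v\<close> is continuous on each of them; outside of
  \<open>closure \<Omega>\<close> it is zero by normalization.
\<close>

lemma Vh_eq_0:
  assumes "polygonal_mesh \<Omega> M" and v: "v \<in> Vh \<Omega> M"
    and zero: "\<And>P x. P \<in> M \<Longrightarrow> x \<in> region P \<Longrightarrow> v x = 0"
  shows "v = (\<lambda>x. 0)"
proof
  fix x
  show "v x = 0"
  proof (cases "x \<in> closure \<Omega>")
    case True
    moreover have "(\<Union>P\<in>M. closure (region P)) = closure \<Omega>"
      using assms(1) by (simp add: polygonal_mesh_def)
    ultimately obtain P where P: "P \<in> M" "x \<in> closure (region P)" by blast
    show ?thesis
      by (rule continuous_constant_on_closure[OF Vh_locD(2)[OF Vh_Vh_loc[OF v P(1)]] zero[OF P(1)] P(2)])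
  qed (use v in \<open>simp add: Vh_def\<close>)
qed

lemma linear_functional_load:
  assumes M: "\<And>P. P \<in> M \<Longrightarrow> region P \<noteq> {}" and g: "\<And>P. P \<in> M \<Longrightarrow> g \<in> L2 (region P)"
  shows "linear_functional_on X (load M g)"
  unfolding load_def[abs_def]
proof (rule linear_functional_on_sum)
  fix P assume P: "P \<in> M"
  have p: "proj_vertex P v \<in> L2 (region P)" for v
    using proj_vertex(1)[OF M[OF P]] P1_subset_Vh_loc Vh_locD(3) by blast
  show "linear_functional_on X (\<lambda>v. L2_inner (region P) g (proj_vertex P v))"
    unfolding linear_functional_on_def L2_inner_sym[of _ g]
    by (simp add: proj_vertex_lincomb[OF M[OF P]] L2_inner_lincomb p g[OF P])
qed

lemma Kh_convex:
  assumes \<Omega>: "open \<Omega>" "bounded \<Omega>" and u: "u \<in> Kh \<Omega> M" "v \<in> Kh \<Omega> M" and t: "0 \<le> t" "t \<le> 1"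
  shows "(\<lambda>x. (1 - t) * u x + t * v x) \<in> Kh \<Omega> M"
proof -
  have V: "(\<lambda>x. (1 - t) * u x + t * v x) \<in> Vh \<Omega> M"
    using u by (intro linear_spaceD(2)[OF linear_space_Vh[OF \<Omega>]]) (auto simp: Kh_def)
  have "AE x in lebesgue_on \<Omega>. 0 \<le> u x" "AE x in lebesgue_on \<Omega>. 0 \<le> v x"
    using u by (auto simp: Kh_def obstacle_cone_def)
  then have "AE x in lebesgue_on \<Omega>. 0 \<le> (1 - t) * u x + t * v x"
    by eventually_elim (use t in simp)
  then show ?thesis using V by (simp add: Kh_def obstacle_cone_def Vh_def)
qed

lemma Kh_closed:
  assumes s: "\<And>k::nat. s k \<in> Kh \<Omega> M" and u: "u \<in> Vh \<Omega> M" and lim: "\<And>x. (\<lambda>k. s k x) \<longlonglongrightarrow> u x"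
  shows "u \<in> Kh \<Omega> M"
proof -
  have "AE x in lebesgue_on \<Omega>. 0 \<le> s k x" for k
    using s[of k] by (auto simp: Kh_def obstacle_cone_def)
  then have "AE x in lebesgue_on \<Omega>. \<forall>k. 0 \<le> s k x" by (simp add: AE_all_countable)
  then have "AE x in lebesgue_on \<Omega>. 0 \<le> u x"
    by eventually_elim (use lim in \<open>auto intro: LIMSEQ_le_const\<close>)
  then show ?thesis using u by (simp add: Kh_def obstacle_cone_def Vh_def)
qed

text \<open>
  The step is the abstract variational inequality for \<open>mh / \<tau> + ah\<close>, with the known part
  \<open>mh U / \<tau>\<close> moved to the right-hand side; the vertices of the mesh separate the space.
\<close>

lemma vem_step_ex1:
  assumes \<Omega>: "open \<Omega>" "bounded \<Omega>" and mesh: "polygonal_mesh \<Omega> M"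
    and M: "\<And>P. P \<in> M \<Longrightarrow> region P \<noteq> {}"
    and Sm: "\<And>P. P \<in> M \<Longrightarrow> computable_spd P (Sm P)"
    and Sa: "\<And>P. P \<in> M \<Longrightarrow> computable_spd P (Sa P)"
    and \<tau>: "0 < \<tau>" and g: "\<And>P. P \<in> M \<Longrightarrow> g \<in> L2 (region P)" and U: "U \<in> Kh \<Omega> M"
  shows "\<exists>!W. vem_step \<Omega> M Sm Sa \<tau> g U W"
proof -
  let ?X = "Vh \<Omega> M" and ?K = "Kh \<Omega> M" and ?F = "\<Union>P\<in>M. set P"
  let ?B = "\<lambda>u v. 1 / \<tau> * mh M Sm u v + 1 * ah M Sa u v"
  let ?l = "\<lambda>v. 1 * load M g v + 1 / \<tau> * mh M Sm U v"
  have fin: "finite M" and simple: "\<And>P. P \<in> M \<Longrightarrow> simple_polygon P"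
    using mesh by (auto simp: polygonal_mesh_def)
  note X = linear_space_Vh[OF \<Omega>, of M]
  have sub: "?X \<subseteq> Vh_loc P" if "P \<in> M" for P using Vh_Vh_loc that by blast
  have UX: "U \<in> ?X" using U by (simp add: Kh_def)
  have mh: "symmetric_bilinear ?X (mh M Sm)"
    unfolding mh_def[abs_def]
    using symmetric_bilinear_subset[OF symmetric_bilinear_mh_loc[OF M Sm] sub]
    by (intro symmetric_bilinear_sum)
  have ah: "symmetric_bilinear ?X (ah M Sa)"
    unfolding ah_def[abs_def]
    using symmetric_bilinear_subset[OF symmetric_bilinear_ah_loc[OF simple M Sa] sub]
    by (intro symmetric_bilinear_sum)
  have B: "symmetric_bilinear ?X ?B" by (rule symmetric_bilinear_lincomb[OF mh ah])
  have ah_nonneg: "0 \<le> ah M Sa v v" if v: "v \<in> ?X" for v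
    unfolding ah_def
    using computable_spd_properties(2)[OF Sa M diff_P1_Vh_loc[OF Vh_Vh_loc[OF v] proj_grad_in_P1[OF simple M Vh_Vh_loc[OF v]]]]
    by (intro sum_nonneg add_nonneg_nonneg grad_inner_nonneg)
  have mh_pos: "0 < mh M Sm v v" if v: "v \<in> ?X" "v \<noteq> (\<lambda>x. 0)" for v
  proof -
    obtain P x where P: "P \<in> M" "x \<in> region P" "v x \<noteq> 0" using Vh_eq_0[OF mesh v(1)] v(2) by blast
    note d = mh_loc_definite[OF M Sm Vh_Vh_loc[OF v(1)]]
    show ?thesis unfolding mh_def
      using d(1) d(2)[OF P(1) P(1) P(1) _ P(2)] P
      by (intro sum_pos2[OF fin P(1)]) (auto simp: less_le)
  qed
  have ip: "inner_product_on ?X ?B"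
    unfolding inner_product_on_def using B mh_pos ah_nonneg \<tau>
    by (auto intro!: add_pos_nonneg)
  have sep: "separated_by ?X ?F"
    unfolding separated_by_def
  proof (intro ballI impI)
    fix v assume v: "v \<in> ?X" and zero: "\<forall>x\<in>?F. v x = 0"
    show "v = (\<lambda>x. 0)"
    proof (rule Vh_eq_0[OF mesh v])
      fix P x assume P: "P \<in> M" and x: "x \<in> region P"
      show "v x = 0"
        by (rule computable_spd_properties(4)[OF Sm[OF P] M[OF P] Vh_Vh_loc[OF v P] _ x]) (use zero P in blast)
    qed
  qed
  have l: "linear_functional_on ?X ?l"
    by (intro linear_functional_on_lincomb linear_functional_load M g symmetric_bilinearD(3)[OF mh X UX])
  have KX: "?K \<subseteq> ?X" by (auto simp: Kh_def)
  have "vem_step \<Omega> M Sm Sa \<tau> g U W \<longleftrightarrow>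
      W \<in> ?K \<and> (\<forall>v\<in>?K. ?l (\<lambda>x. v x - W x) \<le> ?B W (\<lambda>x. v x - W x))" for W
  proof -
    have step: "mh M Sm (\<lambda>x. (W x - U x) / \<tau>) (\<lambda>x. v x - W x)
        = 1 / \<tau> * mh M Sm W (\<lambda>x. v x - W x) - 1 / \<tau> * mh M Sm U (\<lambda>x. v x - W x)"
      if "W \<in> ?K" "v \<in> ?K" for v
    proof -
      have WX: "W \<in> ?X" and z: "(\<lambda>x. v x - W x) \<in> ?X"
        using that KX by (auto intro!: linear_spaceD(3)[OF X])
      have "(\<lambda>x. (W x - U x) / \<tau>) = (\<lambda>x. 1 / \<tau> * W x + (- (1 / \<tau>)) * U x)"
        by (auto simp: diff_divide_distrib)
      then show ?thesis
        using linear_functional_onD(1)[OF symmetric_bilinearD(2)[OF mh z] WX UX, of "1 / \<tau>" "- (1 / \<tau>)"] by simp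
    qed
    have "load M g (\<lambda>x. v x - W x)
          \<le> mh M Sm (\<lambda>x. (W x - U x) / \<tau>) (\<lambda>x. v x - W x) + ah M Sa W (\<lambda>x. v x - W x)
        \<longleftrightarrow> ?l (\<lambda>x. v x - W x) \<le> ?B W (\<lambda>x. v x - W x)" if "W \<in> ?K" "v \<in> ?K" for v
      unfolding step[OF that] by linarith
    then show ?thesis unfolding vem_step_def by blast
  qed
  moreover have "\<exists>!W. W \<in> ?K \<and> (\<forall>v\<in>?K. ?l (\<lambda>x. v x - W x) \<le> ?B W (\<lambda>x. v x - W x))"
  proof (rule variational_inequality_ex1[OF _ X ip sep l KX])
    show "finite ?F" using fin by auto
    show "?K \<noteq> {}" using U by blast
  qed (use Kh_convex[OF \<Omega>] Kh_closed in blast)+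
  ultimately show ?thesis by simp
qed

theorem theorem3p16:
  fixes \<Omega> :: "(real^2) set" and M :: "polygon set" and N :: nat
    and T \<rho> \<sigma>min \<sigma>max \<gamma>min \<gamma>max C :: real
    and f :: "real \<Rightarrow> real^2 \<Rightarrow> real" and u0 U0 :: "real^2 \<Rightarrow> real"
    and Sm Sa :: "polygon \<Rightarrow> form"
  assumes domain: "polygonal_lipschitz_domain \<Omega>"
    and time: "0 < T" "0 < N"
    and data_f: "f \<in> C_Linf {0..T} \<Omega>"
    and data_ft: "\<exists>g\<in>L2_Linf {0..T} \<Omega>. weak_time_deriv {0..T} \<Omega> f g"
    and data_u0: "u0 \<in> Wkinf 2 \<Omega> \<inter> obstacle_cone \<Omega>"
    and mesh: "polygonal_mesh \<Omega> M" "0 < \<rho>" "mesh_regular \<rho> M"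
    and bounds: "0 < \<sigma>min" "0 < \<sigma>max" "0 < \<gamma>min" "0 < \<gamma>max"
    and Sm: "\<And>P. P \<in> M \<Longrightarrow> mass_stabilization \<sigma>min \<sigma>max P (Sm P)"
    and Sa: "\<And>P. P \<in> M \<Longrightarrow> stiffness_stabilization \<gamma>min \<gamma>max P (Sa P)"
    and init: "U0 \<in> Kh \<Omega> M" "L2_norm \<Omega> (\<lambda>x. U0 x - u0 x) \<le> C * mesh_size M"
  shows "\<forall>n<N. \<forall>U :: nat \<Rightarrow> real^2 \<Rightarrow> real.
           U 0 = U0 \<and> (\<forall>k<n. vem_step \<Omega> M Sm Sa (T / N) (f (Suc k * (T / N))) (U k) (U (Suc k)))
           \<longrightarrow> (\<exists>!W. vem_step \<Omega> M Sm Sa (T / N) (f (Suc n * (T / N))) (U n) W)"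
proof (intro allI impI, elim conjE)
  fix n U
  assume n: "n < N" and U: "U 0 = U0"
    "\<forall>k<n. vem_step \<Omega> M Sm Sa (T / N) (f (Suc k * (T / N))) (U k) (U (Suc k))"
  have \<Omega>: "open \<Omega>" "bounded \<Omega>" using domain by (auto simp: polygonal_lipschitz_domain_def)
  have M: "region P \<noteq> {}" "region P \<subseteq> \<Omega>" if P: "P \<in> M" for P
  proof -
    show "region P \<subseteq> \<Omega>" using mesh(1) P by (auto simp: polygonal_mesh_def)
    \<comment> \<open>Star-shapedness puts a ball of positive radius into every element.\<close>
    obtain r c where "r > \<rho> * diameter (region P)" "ball c r \<subseteq> region P"
      using mesh(3) P unfolding mesh_regular_def star_shaped_wrt_ball_def by blast
    moreover have "0 \<le> \<rho> * diameter (region P)"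
      using mesh(2) diameter_ge_0[OF bounded_region[of P]] by simp
    ultimately show "region P \<noteq> {}" using centre_in_ball[of c r] by auto
  qed
  have "real (Suc n) * (T / real N) \<le> real N * (T / real N)"
    using n time by (intro mult_right_mono) auto
  then have "real (Suc n) * (T / real N) \<in> {0..T}" using time by auto
  then have "f (Suc n * (T / N)) \<in> Linf \<Omega>" using data_f by (auto simp: C_Linf_def)
  then have "f (Suc n * (T / N)) \<in> L2 (region P)" if "P \<in> M" for P
    using M(2)[OF that] \<Omega>(1) by (intro Linf_subset_L2 open_region bounded_region)
  moreover have "U n \<in> Kh \<Omega> M"
    using U init(1) by (cases n) (auto simp: vem_step_def)
  ultimately show "\<exists>!W. vem_step \<Omega> M Sm Sa (T / N) (f (Suc n * (T / N))) (U n) W"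
    using Sm Sa time M(1) by (intro vem_step_ex1[OF \<Omega> mesh(1)])
      (auto simp: mass_stabilization_def stiffness_stabilization_def)
qed

end
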